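(* There is a universal constant $c>0$ such that the following holds. Let $(G,\rho)$ be a rooted triangulation with boundary and set $V=V(G)$. Let $\mathcal P_\rho=\{C_v\}_{v\in V}$ be a circle packing of $G$ in $\mathbb D$ such that $C_\rho$ is centered at the origin. If $\varepsilon>0$ and all the circles in $\mathcal P_\rho$ have radius at most $\varepsilon$, then $$\min_{v\in V}\Big(\mathrm{VEL}(\Gamma_{\rho,v})\vee\mathrm{VEL}(\Gamma_v^{\partial})\Big)\ge c\log(1/\varepsilon).$$
   Context: Here $a\vee b=\max(a,b)$ and $\mathbb D=\{z:|z|<1\}$. A triangulation with boundary is a finite simple connected planar map (a graph drawn in the plane, up to orientation-preserving homeomorphism) in which all faces are triangles except for the outer face, whose boundary is a simple cycle. A rooted triangulation with boundary is a pair $(G,\rho)$ where $G$ is a triangulation with boundary and $\rho\in V=V(G)$ is a vertex not belonging to the outer face. A circle packing of a simple connected planar map $G$ with vertex set $V$ is a collection $\{C_v\}_{v\in V}$ of circles in the plane with disjoint interiors such that $C_v$ is tangent to $C_u$ if and only if $u$ and $v$ form an edge, and such that for each $v$ the cyclic order of the circles tangent to $C_v$ agrees with the cyclic order of the neighbors of $v$ in $G$. A circle packing of a triangulation with boundary in $\mathbb D$ is a circle packing in which the circles corresponding to vertices of the outer face are internally tangent to the unit circle $\partial\mathbb D$ and all other circles are contained in $\mathbb D$. Such a packing exists and is unique up to Möbius transformations of $\mathbb D$ onto itself; when $C_\rho$ is required to be centered at the origin it is unique up to rotations. For a function $m:V\to[0,\infty)$ and a finite path $\gamma$ in $G$, let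 $\mathrm{len}_m(\gamma)=\sum_{v\in\gamma}m(v)$ (sum over the vertices visited by $\gamma$, each counted once; in particular the common start and end vertex of a closed path is counted once). For a set $\Gamma$ of finite paths, $\mathrm{len}_m(\Gamma)=\inf_{\gamma\in\Gamma}\mathrm{len}_m(\gamma)$. With $\mathrm{area}(m)=\sum_{v\in V}m(v)^2$, the vertex extremal length of $\Gamma$ is $$\mathrm{VEL}(\Gamma)=\sup_{m}\frac{\mathrm{len}_m(\Gamma)^2}{\mathrm{area}(m)},$$ the supremum being over all $m:V\to[0,\infty)$ that are not identically zero. For $v\ne\rho$, $\Gamma_{\rho,v}$ is the set of paths in $G$ starting and ending at $v$ that have winding number $1$ around $\rho$: the path, viewed as a closed curve in the planar drawing of $G$, does not pass through $\rho$ and has winding number $1$ around the point representing $\rho$. By convention $\mathrm{VEL}(\Gamma_{\rho,\rho})=0$. For any vertex $v$, $\Gamma_v^{\partial}$ is the set of paths in $G$ starting at $v$ and ending at a vertex of the outer face (a path consisting of the single vertex $v$ is allowed if $v$ is on the outer face). *)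

theory Defs
  imports
    "Graph_Theory.Pair_Digraph"
    "Graph_Theory.Digraph_Component"
    "Graph_Theory.Vertex_Walk"
    "HOL-Complex_Analysis.Complex_Analysis"
begin

section \<open>Plane triangulations\<close>

text \<open>
  A planar map is represented by a drawing: the vertices are points of the plane, and the edge
  between adjacent \<open>u\<close> and \<open>v\<close> is drawn as an arc \<open>e u v\<close>, parametrised from \<open>u\<close> to \<open>v\<close>.  As in the
  graph library, a simple undirected graph is a symmetric loop-free digraph without parallel arcs.
\<close>

type_synonym drawing = "complex \<Rightarrow> complex \<Rightarrow> real \<Rightarrow> complex"

definition drawn :: "complex pair_pre_digraph \<Rightarrow> drawing \<Rightarrow> complex set" where
  "drawn G e = pverts G \<union> (\<Union>(u, v)\<in>parcs G. path_image (e u v))"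

definition plane_map :: "complex pair_pre_digraph \<Rightarrow> drawing \<Rightarrow> bool" where
  "plane_map G e \<longleftrightarrow>
     pair_graph G \<and> Digraph_Component.connected (with_proj G) \<and>
     (\<forall>(u, v)\<in>parcs G. arc (e u v) \<and> pathstart (e u v) = u \<and> pathfinish (e u v) = v \<and>
        e v u = reversepath (e u v) \<and> path_image (e u v) \<inter> pverts G = {u, v}) \<and>
     (\<forall>(u, v)\<in>parcs G. \<forall>(x, y)\<in>parcs G. {u, v} \<noteq> {x, y} \<longrightarrow>
        path_image (e u v) \<inter> path_image (e x y) \<subseteq> {u, v} \<inter> {x, y})"

text \<open>The final constant piece does not affect images or winding numbers.\<close>

fun walk_curve :: "drawing \<Rightarrow> complex vwalk \<Rightarrow> real \<Rightarrow> complex" where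
  "walk_curve e (u # v # p) = e u v +++ walk_curve e (v # p)"
| "walk_curve e [v] = linepath v v"

definition bounded_by_cycle ::
    "complex pair_pre_digraph \<Rightarrow> drawing \<Rightarrow> complex set \<Rightarrow> complex vwalk \<Rightarrow> bool" where
  "bounded_by_cycle G e F p \<longleftrightarrow>
     3 \<le> length p \<and> distinct p \<and> vwalk (p @ [hd p]) (with_proj G) \<and>
     frontier F = path_image (walk_curve e (p @ [hd p]))"

text \<open>
  The faces are the components of the complement of the drawing; the outer face is the unbounded
  one, which is the set \<open>outside (drawn G e)\<close>.
\<close>

definition triangulation_with_boundary :: "complex pair_pre_digraph \<Rightarrow> drawing \<Rightarrow> bool" where
  "triangulation_with_boundary G e \<longleftrightarrow>
     plane_map G e \<and>
     (\<forall>F\<in>components (- drawn G e). bounded F \<longrightarrow> (\<exists>p. bounded_by_cycle G e F p \<and> length p = 3)) \<and>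
     (\<exists>p. bounded_by_cycle G e (outside (drawn G e)) p)"

definition outer_verts :: "complex pair_pre_digraph \<Rightarrow> drawing \<Rightarrow> complex set" where
  "outer_verts G e = pverts G \<inter> frontier (outside (drawn G e))"

definition rooted_triangulation ::
    "complex pair_pre_digraph \<Rightarrow> drawing \<Rightarrow> complex \<Rightarrow> bool" where
  "rooted_triangulation G e \<rho> \<longleftrightarrow>
     triangulation_with_boundary G e \<and> \<rho> \<in> pverts G \<and> \<rho> \<notin> outer_verts G e"

section \<open>Cyclic orders\<close>

text \<open>
  Seen from \<open>z\<close>, the points \<open>a\<close>, \<open>b\<close>, \<open>c\<close> lie in three distinct directions that occur in this
  cyclic order counterclockwise.
\<close>

definition ccw :: "complex \<Rightarrow> complex \<Rightarrow> complex \<Rightarrow> complex \<Rightarrow> bool" where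
  "ccw z a b c \<longleftrightarrow>
     0 < Arg2pi ((b - z) / (a - z)) \<and> Arg2pi ((b - z) / (a - z)) < Arg2pi ((c - z) / (a - z))"

definition first_hit :: "(real \<Rightarrow> complex) \<Rightarrow> real \<Rightarrow> complex" where
  "first_hit \<gamma> r = \<gamma> (Inf {t \<in> {0..1}. dist (\<gamma> 0) (\<gamma> t) = r})"

text \<open>
  The cyclic order in which the edges leave \<open>v\<close> is read off from the points where they first meet
  a small circle around \<open>v\<close>.  Edges are arbitrary arcs and need not have tangents at \<open>v\<close>; the
  order is nevertheless the same for all radii below the distances from \<open>v\<close> to its neighbours.
\<close>

definition ccw_neighbours :: "drawing \<Rightarrow> complex \<Rightarrow> complex \<Rightarrow> complex \<Rightarrow> complex \<Rightarrow> bool" where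
  "ccw_neighbours e v a b c \<longleftrightarrow>
     (\<forall>\<^sub>F r in at_right 0. ccw v (first_hit (e v a) r) (first_hit (e v b) r) (first_hit (e v c) r))"

section \<open>Circle packings\<close>

text \<open>The circle of the vertex \<open>v\<close> is \<open>sphere (cen v) (rad v)\<close>.\<close>

definition tangent :: "complex set \<Rightarrow> complex set \<Rightarrow> bool" where
  "tangent C D \<longleftrightarrow> (\<exists>!p. p \<in> C \<inter> D)"

definition circle_packing ::
    "complex pair_pre_digraph \<Rightarrow> drawing \<Rightarrow> (complex \<Rightarrow> complex) \<Rightarrow> (complex \<Rightarrow> real) \<Rightarrow> bool" where
  "circle_packing G e cen rad \<longleftrightarrow>
     (\<forall>v\<in>pverts G. 0 < rad v) \<and>
     (\<forall>u\<in>pverts G. \<forall>v\<in>pverts G. u \<noteq> v \<longrightarrow>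
        ball (cen u) (rad u) \<inter> ball (cen v) (rad v) = {} \<and>
        (tangent (sphere (cen u) (rad u)) (sphere (cen v) (rad v)) \<longleftrightarrow> (u, v) \<in> parcs G)) \<and>
     (\<forall>v a b c. (v, a) \<in> parcs G \<longrightarrow> (v, b) \<in> parcs G \<longrightarrow> (v, c) \<in> parcs G \<longrightarrow>
        (ccw_neighbours e v a b c \<longleftrightarrow> ccw (cen v) (cen a) (cen b) (cen c)))"

definition circle_packing_in_disc ::
    "complex pair_pre_digraph \<Rightarrow> drawing \<Rightarrow> (complex \<Rightarrow> complex) \<Rightarrow> (complex \<Rightarrow> real) \<Rightarrow> bool" where
  "circle_packing_in_disc G e cen rad \<longleftrightarrow>
     circle_packing G e cen rad \<and>
     (\<forall>v\<in>outer_verts G e. cball (cen v) (rad v) \<subseteq> cball 0 1 \<and>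
        tangent (sphere (cen v) (rad v)) (sphere 0 1)) \<and>
     (\<forall>v\<in>pverts G - outer_verts G e. sphere (cen v) (rad v) \<subseteq> ball 0 1)"

section \<open>Vertex extremal length\<close>

text \<open>
  Paths are walks, which may revisit vertices; every visited vertex contributes once to the length.
\<close>

definition len :: "(complex \<Rightarrow> real) \<Rightarrow> complex vwalk \<Rightarrow> real" where
  "len m p = (\<Sum>v\<in>set p. m v)"

definition area :: "complex set \<Rightarrow> (complex \<Rightarrow> real) \<Rightarrow> real" where
  "area V m = (\<Sum>v\<in>V. (m v)\<^sup>2)"

definition VEL :: "complex set \<Rightarrow> complex vwalk set \<Rightarrow> ereal" where
  "VEL V \<Gamma> =
     (SUP m \<in> {m. (\<forall>v\<in>V. 0 \<le> m v) \<and> (\<exists>v\<in>V. m v \<noteq> 0)}.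
        (INF p\<in>\<Gamma>. ereal (len m p))\<^sup>2 / ereal (area V m))"

definition walks_around ::
    "complex pair_pre_digraph \<Rightarrow> drawing \<Rightarrow> complex \<Rightarrow> complex \<Rightarrow> complex vwalk set" where
  "walks_around G e \<rho> v =
     {p. vwalk p (with_proj G) \<and> hd p = v \<and> last p = v \<and>
         \<rho> \<notin> path_image (walk_curve e p) \<and> winding_number (walk_curve e p) \<rho> = 1}"

definition VEL_around ::
    "complex pair_pre_digraph \<Rightarrow> drawing \<Rightarrow> complex \<Rightarrow> complex \<Rightarrow> ereal" where
  "VEL_around G e \<rho> v = (if v = \<rho> then 0 else VEL (pverts G) (walks_around G e \<rho> v))"

definition walks_to_boundary ::
    "complex pair_pre_digraph \<Rightarrow> drawing \<Rightarrow> complex \<Rightarrow> complex vwalk set" where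
  "walks_to_boundary G e v =
     {p. vwalk p (with_proj G) \<and> hd p = v \<and> last p \<in> outer_verts G e}"

end

theory Submission
  imports Defs
begin

text \<open>
  Every walk in question starts at \<open>v\<close>, and its circles have to cross an annulus around the center
  \<open>z\<close> of \<open>C\<^sub>v\<close>.  A walk to the outer face ends at a circle that touches the unit circle, so it gets
  as far as \<open>1 - \<epsilon> - \<bar>z\<bar>\<close> from \<open>z\<close>.  A walk around the root gets as far as \<open>\<bar>z\<bar>\<close>, since
  otherwise its circles would all have their centers on one side of a line through the origin and
  could not surround the origin.  One of the two distances is at least \<open>1/4\<close> when \<open>\<epsilon> \<le> 1/64\<close>.

  For walks that reach the distance \<open>R\<close> from \<open>z\<close>, the metric
  \<open>m u = 2 rad u / max (dist (cen u) z) (2 \<epsilon>)\<close>, a discrete form of \<open>\<bar>dw\<bar> / \<bar>w - z\<bar>\<close>, gives the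
  bound.  The function \<open>ln (max (dist (cen u) z) (2 \<epsilon>))\<close> changes by at most \<open>m a + m b\<close> between
  tangent circles, which makes every such walk at least \<open>ln (R / (2 \<epsilon>)) / 2\<close> long
  (\<open>ln_increment_tangent_le\<close>, \<open>vwalk_increment_le\<close>).  The discs are disjoint, so
  each dyadic annulus contributes a bounded amount to the area, which is therefore of order
  \<open>ln (1 / \<epsilon>)\<close> (\<open>area_log_metric_le\<close>).  For \<open>\<epsilon> > 1/64\<close> it suffices that every walk visits \<open>v\<close>.

  The topological point is that a walk with winding number 1 around the root in the given drawing
  also surrounds the origin in the packing.  The vertices off the walk with nonzero winding number form a set of interior vertices
  whose other neighbours are on the walk.  By a maximum principle
  (\<open>interior_vertex_neighbour_beyond\<close>) the center of an interior vertex never lies on the boundary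
  of a half-plane that contains the centers of all its neighbours.  Going from the root in any
  direction therefore leads to a vertex of the walk (\<open>winding_walk_crosses_halfplane\<close>).

  The maximum principle follows from two facts on the drawing, both of which come from the Jordan
  curve theorem.  An edge at an interior vertex lies in two faces (\<open>interior_edge_two_faces\<close>), and the
  boundary triangle of a face does not separate any vertex from the outer face
  (\<open>face_triangle_not_separating\<close>).  By the second one, the triangle spanned by the centers of a face
  contains no other circle, because a chain of tangent circles cannot leave that triangle and would
  have to reach the unit circle (\<open>face_triangle_contains_no_center\<close>).  So, seen from an interior vertex
  \<open>v\<close>, no neighbour lies within the angle of a face at \<open>v\<close>.  The two faces at the edge to a neighbour
  are therefore on different sides of it, each with an angle less than \<open>\<pi>\<close>, and the neighbours
  cannot all lie in a half-plane.
\<close>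

section \<open>Faces of a plane triangulation\<close>

text \<open>
  By invariance of dimension, an open piece of the plane does not embed into an interval.
\<close>

lemma interior_arc_eq_empty:
  fixes g :: "real \<Rightarrow> complex"
  assumes "arc g"
  shows "interior (path_image g) = {}"
proof (rule ccontr)
  assume ne: "interior (path_image g) \<noteq> {}"
  obtain h where h: "homeomorphism {0..1} (path_image g) g h"
    using homeomorphism_arc[OF assms] by blast
  have "continuous_on (path_image g) h" "\<And>y. y \<in> path_image g \<Longrightarrow> g (h y) = y"
    using h unfolding homeomorphism_def by blast+
  then have "continuous_on (interior (path_image g)) h" "inj_on h (interior (path_image g))"
    using interior_subset[of "path_image g"]
    by (blast intro: continuous_on_subset inj_on_subset inj_on_inverseI)+
  then have "DIM(complex) \<le> DIM(real)"
    using invariance_of_dimension ne open_interior by blast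
  then show False by simp
qed

locale plane_triangulation =
  fixes G :: "complex pair_pre_digraph" and e :: drawing
  assumes triangulation: "triangulation_with_boundary G e"
begin

abbreviation edge :: "complex \<Rightarrow> complex \<Rightarrow> complex set" where
  "edge u v \<equiv> path_image (e u v)"

abbreviation "bounded_faces \<equiv> {F \<in> components (- drawn G e). bounded F}"

lemma plane_map: "plane_map G e" and pair_graph: "pair_graph G"
  using triangulation by (simp_all add: triangulation_with_boundary_def plane_map_def)

sublocale graph: pair_graph G by (rule pair_graph)

lemma arc_verts: "(u, v) \<in> parcs G \<Longrightarrow> u \<in> pverts G" "(u, v) \<in> parcs G \<Longrightarrow> v \<in> pverts G"
  by (auto intro: graph.in_arcsD1 graph.in_arcsD2)

lemma arc_sym: "(u, v) \<in> parcs G \<Longrightarrow> (v, u) \<in> parcs G"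
  using graph.pair_sym_arcs unfolding symmetric_def sym_def by simp

lemma arc_neq: "(u, v) \<in> parcs G \<Longrightarrow> u \<noteq> v"
  using graph.pair_no_loops by fastforce

lemma edge_arc:
  assumes "(u, v) \<in> parcs G"
  shows "arc (e u v)" "pathstart (e u v) = u" "pathfinish (e u v) = v"
    "edge u v \<inter> pverts G = {u, v}" "edge v u = edge u v" "u \<in> edge u v" "v \<in> edge u v"
proof -
  have *: "arc (e u v) \<and> pathstart (e u v) = u \<and> pathfinish (e u v) = v \<and>
        e v u = reversepath (e u v) \<and> edge u v \<inter> pverts G = {u, v}"
    using plane_map assms unfolding plane_map_def by (elim conjE) (drule (1) bspec, simp)
  then show "arc (e u v)" "pathstart (e u v) = u" "pathfinish (e u v) = v"
    "edge u v \<inter> pverts G = {u, v}" "u \<in> edge u v" "v \<in> edge u v" by blast+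
  from * show "edge v u = edge u v" by simp
qed

lemma edges_Int:
  assumes "(u, v) \<in> parcs G" "(x, y) \<in> parcs G" "{u, v} \<noteq> {x, y}"
  shows "edge u v \<inter> edge x y \<subseteq> {u, v} \<inter> {x, y}"
proof -
  have "\<forall>(u, v)\<in>parcs G. \<forall>(x, y)\<in>parcs G. {u, v} \<noteq> {x, y} \<longrightarrow> edge u v \<inter> edge x y \<subseteq> {u, v} \<inter> {x, y}"
    using plane_map unfolding plane_map_def by (elim conjE)
  then show ?thesis using assms by fast
qed

lemma compact_drawn: "compact (drawn G e)"
  unfolding drawn_def
proof (rule compact_Un)
  show "compact (\<Union>(u, v)\<in>parcs G. edge u v)"
    using graph.pair_finite_arcs edge_arc(1)
    by (intro compact_UN) (auto intro!: compact_path_image arc_imp_path)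
qed (simp add: graph.pair_finite_verts finite_imp_compact)

lemma open_Compl_drawn: "open (- drawn G e)"
  using compact_drawn compact_imp_closed open_Compl by blast

lemma interior_drawn: "interior (drawn G e) = {}"
proof -
  have *: "closed (\<Union>(u, v)\<in>S. edge u v) \<and> interior (\<Union>(u, v)\<in>S. edge u v) = {}"
    if "finite S" "S \<subseteq> parcs G" for S
    using that
  proof (induction S)
    case empty
    then show ?case by simp
  next
    case (insert a S)
    obtain u v where a: "a = (u, v)" by force
    have "arc (e u v)" using insert.prems edge_arc(1) a by auto
    then have "closed (edge u v)" "interior (edge u v) = {}"
      using interior_arc_eq_empty closed_path_image arc_imp_path by blast+
    then show ?case using insert a
      by (simp add: interior_closed_Un_empty_interior closed_Un)
  qed
  have "interior (pverts G) = {}"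
    using graph.pair_finite_verts finite_imp_closed empty_interior_finite by blast
  with *[OF graph.pair_finite_arcs subset_refl] show ?thesis
    unfolding drawn_def by (subst Un_commute) (simp add: interior_closed_Un_empty_interior)
qed

lemma walk_curve_path:
  assumes "vwalk p (with_proj G)"
  shows "path (walk_curve e p)" "pathstart (walk_curve e p) = hd p"
    "pathfinish (walk_curve e p) = last p"
    "path_image (walk_curve e p) = set p \<union> (\<Union>(u, v)\<in>set (vwalk_arcs p). edge u v)"
proof -
  have "path (walk_curve e p) \<and> pathstart (walk_curve e p) = hd p \<and>
    pathfinish (walk_curve e p) = last p \<and>
    path_image (walk_curve e p) = set p \<union> (\<Union>(u, v)\<in>set (vwalk_arcs p). edge u v)"
    using assms
  proof (induction p rule: vwalk_induct)
    case (Base u)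
    then show ?case by (simp flip: linepath_refl)
  next
    case (Cons u v es)
    then have uv: "(u, v) \<in> parcs G" by simp
    show ?case
      using Cons.IH edge_arc[OF uv]
      by (auto simp: path_image_join arc_imp_path)
  qed
  then show "path (walk_curve e p)" "pathstart (walk_curve e p) = hd p"
    "pathfinish (walk_curve e p) = last p"
    "path_image (walk_curve e p) = set p \<union> (\<Union>(u, v)\<in>set (vwalk_arcs p). edge u v)" by blast+
qed

lemma vwalk_arcs_verts: "(u, v) \<in> set (vwalk_arcs p) \<Longrightarrow> u \<in> set p \<and> v \<in> set p"
  by (induction p rule: vwalk_arcs.induct) auto

lemma walk_curve_drawn:
  assumes "vwalk p (with_proj G)"
  shows "path_image (walk_curve e p) \<subseteq> drawn G e"
  unfolding walk_curve_path(4)[OF assms] drawn_def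
  using assms unfolding vwalk_def by auto

lemma walk_curve_verts:
  assumes "vwalk p (with_proj G)"
  shows "path_image (walk_curve e p) \<inter> pverts G = set p"
proof -
  have "edge u v \<inter> pverts G \<subseteq> set p" if "(u, v) \<in> set (vwalk_arcs p)" for u v
  proof -
    have "(u, v) \<in> parcs G" using that assms unfolding vwalk_def by auto
    then show ?thesis using edge_arc(4)[of u v] vwalk_arcs_verts[OF that] by simp
  qed
  then show ?thesis
    unfolding walk_curve_path(4)[OF assms] using assms unfolding vwalk_def by auto
qed

text \<open>
  Distinct edges meet in vertices only, so a point in the relative interior of an edge determines
  the edge.
\<close>

lemma walk_curve_contains_edge:
  assumes p: "vwalk p (with_proj G)" and uv: "(u, v) \<in> parcs G"
    and x: "x \<in> edge u v" "x \<notin> {u, v}" "x \<in> path_image (walk_curve e p)"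
  shows "edge u v \<subseteq> path_image (walk_curve e p)" "{u, v} \<subseteq> set p"
proof -
  have "x \<notin> pverts G" using edge_arc(4)[OF uv] x by blast
  then have "x \<notin> set p" using p unfolding vwalk_def by auto
  then obtain s t where st: "(s, t) \<in> set (vwalk_arcs p)" "x \<in> edge s t"
    using x(3) unfolding walk_curve_path(4)[OF p] by auto
  then have st': "(s, t) \<in> parcs G" using p unfolding vwalk_def by auto
  have eq: "{u, v} = {s, t}" using edges_Int[OF uv st'] x st(2) by blast
  then have "edge u v = edge s t"
    using edge_arc(5)[OF st'] by (auto simp: doubleton_eq_iff)
  then show "edge u v \<subseteq> path_image (walk_curve e p)"
    unfolding walk_curve_path(4)[OF p] using st(1) by auto
  show "{u, v} \<subseteq> set p" unfolding eq using vwalk_arcs_verts[OF st(1)] by simp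
qed

lemma edge_avoids_walk_curve:
  assumes p: "vwalk p (with_proj G)" and uv: "(u, v) \<in> parcs G" "u \<notin> set p" "v \<notin> set p"
  shows "edge u v \<inter> path_image (walk_curve e p) = {}"
  using walk_curve_contains_edge(2)[OF p uv(1)] walk_curve_verts[OF p] arc_verts[OF uv(1)] uv(2,3)
  by blast

definition boundary_triangle :: "complex set \<Rightarrow> complex \<Rightarrow> complex \<Rightarrow> complex \<Rightarrow> bool" where
  "boundary_triangle F a b c \<longleftrightarrow> distinct [a, b, c] \<and>
     (a, b) \<in> parcs G \<and> (b, c) \<in> parcs G \<and> (c, a) \<in> parcs G \<and>
     frontier F = edge a b \<union> edge b c \<union> edge c a"

lemma boundary_triangle_rotate: "boundary_triangle F a b c \<Longrightarrow> boundary_triangle F b c a"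
  unfolding boundary_triangle_def by auto

lemma boundary_triangle_flip:
  assumes "boundary_triangle F a b c"
  shows "boundary_triangle F b a c"
proof -
  have *: "distinct [a, b, c]" "(a, b) \<in> parcs G" "(b, c) \<in> parcs G" "(c, a) \<in> parcs G"
    "frontier F = edge a b \<union> edge b c \<union> edge c a"
    using assms unfolding boundary_triangle_def by blast+
  have "frontier F = edge b a \<union> edge a c \<union> edge c b"
    unfolding *(5) edge_arc(5)[OF *(2)] edge_arc(5)[OF *(3)] edge_arc(5)[OF *(4)] by blast
  then show ?thesis unfolding boundary_triangle_def using * arc_sym by auto
qed

lemma bounded_face_boundary:
  assumes "F \<in> bounded_faces"
  obtains a b c where
    "distinct [a, b, c]" "(a, b) \<in> parcs G" "(b, c) \<in> parcs G" "(c, a) \<in> parcs G"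
    "frontier F = path_image (walk_curve e [a, b, c, a])"
    "frontier F = edge a b \<union> edge b c \<union> edge c a"
    "vwalk [a, b, c, a] (with_proj G)"
proof -
  have "\<exists>p. bounded_by_cycle G e F p \<and> length p = 3"
    using triangulation assms unfolding triangulation_with_boundary_def by blast
  then obtain p where p: "bounded_by_cycle G e F p" "length p = 3" by blast
  then obtain a b c where abc: "p = [a, b, c]"
    by (auto simp: length_Suc_conv numeral_3_eq_3)
  from p have w: "vwalk [a, b, c, a] (with_proj G)"
    and fr: "frontier F = path_image (walk_curve e [a, b, c, a])" and d: "distinct [a, b, c]"
    unfolding bounded_by_cycle_def abc by auto
  have arcs: "(a, b) \<in> parcs G" "(b, c) \<in> parcs G" "(c, a) \<in> parcs G"
    using w unfolding vwalk_def by auto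
  have "frontier F = edge a b \<union> edge b c \<union> edge c a"
    unfolding fr walk_curve_path(4)[OF w] using edge_arc(6,7)[OF arcs(1)] edge_arc(6,7)[OF arcs(2)]
    by auto
  with d arcs fr w that show ?thesis by blast
qed

text \<open>
  A bounded face is connected and off its boundary triangle, so it lies on one side of it, and it
  fills that side because its frontier does not enter it.
\<close>

lemma bounded_face_Jordan:
  assumes F: "F \<in> bounded_faces"
  shows "F = inside (frontier F)" "frontier (outside (frontier F)) = frontier F"
    "Topological_Spaces.connected (outside (frontier F))" "\<not> bounded (outside (frontier F))"
proof -
  obtain a b c where abc: "distinct [a, b, c]"
    "(a, b) \<in> parcs G" "(b, c) \<in> parcs G" "(c, a) \<in> parcs G"
    and fr: "frontier F = edge a b \<union> edge b c \<union> edge c a"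
    using bounded_face_boundary[OF F] by metis
  note ab = edge_arc[OF abc(2)] and bc = edge_arc[OF abc(3)] and ca = edge_arc[OF abc(4)]
  define g where "g = e a b +++ (e b c +++ e c a)"
  have "edge b c \<inter> edge c a \<subseteq> {c}"
    using edges_Int[OF abc(3,4)] abc(1) by (auto simp: doubleton_eq_iff)
  then have arc2: "arc (e b c +++ e c a)"
    using ab bc ca by (intro arc_join) auto
  have "edge a b \<inter> edge b c \<subseteq> {b}" "edge a b \<inter> edge c a \<subseteq> {a}"
    using edges_Int[OF abc(2,3)] edges_Int[OF abc(2,4)] abc(1) by (auto simp: doubleton_eq_iff)
  then have g: "simple_path g" "pathfinish g = pathstart g"
    unfolding g_def using ab bc ca arc2
    by (intro simple_path_join_loop; simp add: path_image_join; blast) (use ab ca in simp)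
  have J: "path_image g = frontier F"
    unfolding fr g_def using ab bc ca by (auto simp: path_image_join)
  note jordan = Jordan_inside_outside[OF g, unfolded J]
  from jordan show out: "frontier (outside (frontier F)) = frontier F"
    "Topological_Spaces.connected (outside (frontier F))" "\<not> bounded (outside (frontier F))"
    by simp_all
  from jordan have conn: "Topological_Spaces.connected (inside (frontier F))"
    and cover: "inside (frontier F) \<union> outside (frontier F) = - frontier F"
    by simp_all
  have op: "open F" "F \<noteq> {}" "bounded F"
    using F open_components[OF open_Compl_drawn] in_components_nonempty by auto
  have off: "S \<subseteq> F"
    if "Topological_Spaces.connected S" "S \<inter> frontier F = {}" "S \<inter> F \<noteq> {}" for S
    using connected_Int_frontier[OF that(1,3)] that(2) by blast
  have disj: "F \<inter> frontier F = {}" using op(1) by (simp add: frontier_def interior_open)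
  have "F \<inter> outside (frontier F) = {}"
  proof (rule ccontr)
    assume "F \<inter> outside (frontier F) \<noteq> {}"
    then have "outside (frontier F) \<subseteq> F" using off[OF out(2)] cover by blast
    then show False using out(3) op(3) bounded_subset by blast
  qed
  with disj have sub: "F \<subseteq> inside (frontier F)" using cover by blast
  moreover have "inside (frontier F) \<subseteq> F"
    using off[OF conn] cover op(2) sub by blast
  ultimately show "F = inside (frontier F)" by (rule subset_antisym)
qed

text \<open>
  Faces with the same boundary triangle coincide, since each is the inside of the triangle.
\<close>

lemma finite_bounded_faces: "finite bounded_faces"
proof (rule finite_subset)
  let ?f = "\<lambda>(a, b, c). inside (edge a b \<union> edge b c \<union> edge c a)"
  show "bounded_faces \<subseteq> ?f ` (pverts G \<times> pverts G \<times> pverts G)"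
  proof
    fix F assume F: "F \<in> bounded_faces"
    obtain a b c where "(a, b) \<in> parcs G" "(c, a) \<in> parcs G"
      "frontier F = edge a b \<union> edge b c \<union> edge c a"
      using bounded_face_boundary[OF F] by metis
    then have "F = ?f (a, b, c)" "(a, b, c) \<in> pverts G \<times> pverts G \<times> pverts G"
      using bounded_face_Jordan(1)[OF F] arc_verts by auto
    then show "F \<in> ?f ` (pverts G \<times> pverts G \<times> pverts G)" by (rule image_eqI)
  qed
qed (simp add: graph.pair_finite_verts)

lemma finite_bounded_faces_such_that: "finite {F \<in> bounded_faces. P F}"
  by (rule finite_subset[OF _ finite_bounded_faces]) auto

lemma not_in_outside_imp_bounded_face:
  assumes "y \<notin> drawn G e" "y \<notin> outside (drawn G e)"
  obtains F where "F \<in> bounded_faces" "y \<in> F"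
proof
  show "connected_component_set (- drawn G e) y \<in> bounded_faces"
    using assms by (auto simp: outside_def componentsI)
  show "y \<in> connected_component_set (- drawn G e) y"
    using assms by simp
qed

text \<open>
  There are finitely many bounded faces and the drawing is nowhere dense, so away from the outer
  face the closures of the faces cover a neighbourhood of each point.
\<close>

lemma bounded_faces_nhd:
  assumes "x \<notin> closure (outside (drawn G e))"
  obtains N where "open N" "x \<in> N" "N \<subseteq> (\<Union>F\<in>{F \<in> bounded_faces. x \<in> closure F}. closure F)"
proof
  let ?C = "\<Union>F\<in>{F \<in> bounded_faces. x \<notin> closure F}. closure F"
  let ?D = "\<Union>F\<in>{F \<in> bounded_faces. x \<in> closure F}. closure F"
  define N where "N = - closure (outside (drawn G e)) - ?C"
  have cl: "closed ?C" "closed ?D"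
    by (intro closed_UN finite_bounded_faces_such_that; simp)+
  show "open N" unfolding N_def using cl by (intro open_Diff) auto
  show "x \<in> N" unfolding N_def using assms by auto
  show "N \<subseteq> ?D"
  proof (rule ccontr)
    assume "\<not> N \<subseteq> ?D"
    then have "N - ?D \<noteq> {}" "open (N - ?D)" using \<open>open N\<close> cl by auto
    then obtain y where y: "y \<in> N - ?D" "y \<notin> drawn G e"
      using interior_drawn interior_maximal[of "N - ?D" "drawn G e"] by blast
    then have "y \<notin> outside (drawn G e)" unfolding N_def using closure_subset by blast
    then obtain F where "F \<in> bounded_faces" "y \<in> F"
      using not_in_outside_imp_bounded_face y(2) by blast
    then show False using y unfolding N_def using closure_subset[of F] by blast
  qed
qed

lemma bounded_face_closure:
  assumes "F \<in> bounded_faces"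
  shows "closure F = F \<union> frontier F" "F \<inter> drawn G e = {}" "open F"
proof -
  show "open F" using assms open_components[OF open_Compl_drawn] by simp
  then show "closure F = F \<union> frontier F"
    using closure_Un_frontier by blast
  show "F \<inter> drawn G e = {}" using assms in_components_subset by fastforce
qed

lemma outer_boundary:
  obtains q where "vwalk q (with_proj G)"
    "frontier (outside (drawn G e)) = path_image (walk_curve e q)"
    "outer_verts G e = set q"
proof -
  obtain p where p: "bounded_by_cycle G e (outside (drawn G e)) p"
    using triangulation unfolding triangulation_with_boundary_def by blast
  then have w: "vwalk (p @ [hd p]) (with_proj G)"
    and fr: "frontier (outside (drawn G e)) = path_image (walk_curve e (p @ [hd p]))"
    unfolding bounded_by_cycle_def by auto
  show ?thesis
  proof
    show "vwalk (p @ [hd p]) (with_proj G)" by fact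
    show "frontier (outside (drawn G e)) = path_image (walk_curve e (p @ [hd p]))" by fact
    show "outer_verts G e = set (p @ [hd p])"
      unfolding outer_verts_def fr using walk_curve_verts[OF w] by blast
  qed
qed

lemma closure_outside_drawn:
  assumes "x \<in> drawn G e" "x \<in> closure (outside (drawn G e))"
  shows "x \<in> frontier (outside (drawn G e))"
proof -
  have "open (outside (drawn G e))"
    using compact_drawn by (simp add: open_outside compact_imp_closed)
  moreover have "x \<notin> outside (drawn G e)" using assms(1) by (simp add: outside_def)
  ultimately show ?thesis using assms by (simp add: frontier_def interior_open)
qed

definition face_triangle :: "complex \<Rightarrow> complex \<Rightarrow> complex \<Rightarrow> bool" where
  "face_triangle a b c \<longleftrightarrow> (\<exists>F\<in>bounded_faces. boundary_triangle F a b c)"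

text \<open>
  One face \<open>F\<close> near a point of the edge
  is the inside of a Jordan curve through that point, so the outside of that curve also comes
  close to the point, and there it has to be covered by the closure of a second face.
\<close>

lemma interior_edge_two_faces:
  assumes vb: "(v, b) \<in> parcs G" and v: "v \<notin> outer_verts G e"
  obtains c c' where "c \<noteq> c'" "face_triangle v b c" "face_triangle v b c'"
proof -
  obtain x where x: "x \<in> edge v b" "x \<notin> {v, b}"
  proof -
    have "Topological_Spaces.connected (edge v b)"
      using edge_arc(1)[OF vb] by (simp add: arc_imp_path connected_path_image)
    moreover have "\<not> (\<exists>a. edge v b = {a})" "edge v b \<noteq> {}"
      using edge_arc(6,7)[OF vb] arc_neq[OF vb] by auto
    ultimately have "infinite (edge v b)"
      using connected_finite_iff_sing by blast
    then have "\<not> edge v b \<subseteq> {v, b}" using finite_subset by blast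
    then show ?thesis using that by blast
  qed
  have xD: "x \<in> drawn G e" unfolding drawn_def using vb x by auto
  have "x \<notin> closure (outside (drawn G e))"
  proof
    assume "x \<in> closure (outside (drawn G e))"
    then have "x \<in> frontier (outside (drawn G e))" using closure_outside_drawn xD by blast
    then show False
      using outer_boundary walk_curve_contains_edge(2)[OF _ vb x] v by (metis insert_subset)
  qed
  then obtain N where N: "open N" "x \<in> N"
    "N \<subseteq> (\<Union>F\<in>{F \<in> bounded_faces. x \<in> closure F}. closure F)"
    by (rule bounded_faces_nhd)
  have third: "\<exists>c. boundary_triangle F v b c"
    if F: "F \<in> bounded_faces" and xF: "x \<in> closure F" for F
  proof -
    obtain p q r where bd: "boundary_triangle F p q r"
      using bounded_face_boundary[OF F] unfolding boundary_triangle_def by metis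
    then have pqr: "(p, q) \<in> parcs G" "(q, r) \<in> parcs G" "(r, p) \<in> parcs G"
      and fr: "frontier F = edge p q \<union> edge q r \<union> edge r p"
      unfolding boundary_triangle_def by blast+
    have xfr: "x \<in> frontier F" using bounded_face_closure[OF F] xF xD by blast
    have same: "{s, t} = {v, b}" if "(s, t) \<in> parcs G" "x \<in> edge s t" for s t
      using edges_Int[OF vb that(1)] x that(2) by blast
    have ori: "\<exists>c. boundary_triangle F v b c"
      if "boundary_triangle F s t u" "{s, t} = {v, b}" for s t u
      using that boundary_triangle_flip by (metis doubleton_eq_iff)
    show ?thesis
      using xfr same pqr ori bd boundary_triangle_rotate unfolding fr by (metis Un_iff)
  qed
  from N obtain F where F: "F \<in> bounded_faces" "x \<in> closure F" by blast
  note J = bounded_face_Jordan[OF F(1)]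
  have "x \<in> closure (outside (frontier F))"
    using bounded_face_closure[OF F(1)] F(2) xD J(2) by (auto simp: frontier_def)
  then obtain y where y: "y \<in> N" "y \<in> outside (frontier F)"
    using N(1,2) open_Int_closure_eq_empty[of N "outside (frontier F)"] by blast
  obtain F' where F': "F' \<in> bounded_faces" "x \<in> closure F'" "y \<in> closure F'"
    using N(3) y(1) by blast
  have "y \<notin> closure F"
    using bounded_face_closure(1)[OF F(1)] J(1) y(2) inside_Int_outside
      outside_no_overlap by (metis Un_iff disjoint_iff)
  then have "frontier F \<noteq> frontier F'"
    using J(1) bounded_face_Jordan(1)[OF F'(1)] F'(3) by metis
  moreover obtain c c' where "boundary_triangle F v b c" "boundary_triangle F' v b c'"
    using third[OF F] third[OF F'(1,2)] by blast
  moreover from this have "c \<noteq> c'"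
    using \<open>frontier F \<noteq> frontier F'\<close> unfolding boundary_triangle_def by auto
  ultimately show ?thesis
    using that F(1) F'(1) unfolding face_triangle_def by blast
qed

text \<open>
  If \<open>K\<close> had no outer
  vertex, then the closed faces at \<open>K\<close> would form a bounded set that is open and closed off the
  triangle.  As the inside of the triangle is a face and has no vertices, \<open>K\<close> lies outside the
  triangle, and the unbounded outside would be contained in that set.
\<close>

lemma face_triangle_not_separating:
  assumes tri: "face_triangle a b c"
    and K: "K \<subseteq> pverts G - {a, b, c}" "K \<noteq> {}"
    and nbrs: "\<And>k u. k \<in> K \<Longrightarrow> (k, u) \<in> parcs G \<Longrightarrow> u \<in> K \<union> {a, b, c}"
  shows "K \<inter> outer_verts G e \<noteq> {}"
proof
  assume out: "K \<inter> outer_verts G e = {}"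
  from tri obtain F0 where arcs: "(a, b) \<in> parcs G" "(b, c) \<in> parcs G" "(c, a) \<in> parcs G"
    and F0: "F0 \<in> bounded_faces" "frontier F0 = edge a b \<union> edge b c \<union> edge c a"
    unfolding face_triangle_def boundary_triangle_def by blast
  let ?J = "frontier F0"
  note jordan = bounded_face_Jordan[OF F0(1)]
  have KJ: "K \<inter> ?J = {}"
    unfolding F0(2) using K(1) edge_arc(4)[OF arcs(1)] edge_arc(4)[OF arcs(2)] edge_arc(4)[OF arcs(3)]
    by blast
  define W where "W = (\<Union>F\<in>{F \<in> bounded_faces. frontier F \<inter> K \<noteq> {}}. closure F)"
  have W: "closed W" "bounded W"
    unfolding W_def by (intro closed_UN bounded_UN finite_bounded_faces_such_that; simp add: bounded_closure)+
  \<comment> \<open>The boundary walk of each face near \<open>x\<close> runs through \<open>x\<close> and hence through \<open>k\<close>, so all faces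
    near \<open>x\<close> are faces at \<open>K\<close>.\<close>
  have near: "\<exists>N. open N \<and> x \<in> N \<and> N \<subseteq> W"
    if k: "k \<in> K" "x = k \<or> (\<exists>(s, t)\<in>parcs G. x \<in> edge s t - {s, t} \<and> k \<in> {s, t})" for x k
  proof -
    have xD: "x \<in> drawn G e" unfolding drawn_def using k K(1) by auto
    have k_on: "k \<in> path_image (walk_curve e p)"
      if "vwalk p (with_proj G)" "x \<in> path_image (walk_curve e p)" for p
      using k(2)
    proof
      assume "\<exists>(s, t)\<in>parcs G. x \<in> edge s t - {s, t} \<and> k \<in> {s, t}"
      then obtain s t where st: "(s, t) \<in> parcs G" "x \<in> edge s t" "x \<notin> {s, t}" "k \<in> {s, t}"
        by blast
      then show ?thesis
        using walk_curve_contains_edge(1)[OF that(1) st(1-3) that(2)] edge_arc(6,7)[OF st(1)]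
        by blast
    qed (use that(2) in simp)
    have "x \<notin> closure (outside (drawn G e))"
    proof
      assume "x \<in> closure (outside (drawn G e))"
      then have "x \<in> frontier (outside (drawn G e))" using closure_outside_drawn xD by blast
      then have "k \<in> outer_verts G e"
        using outer_boundary k_on K(1) k(1) unfolding outer_verts_def
        by (metis Diff_iff IntI subset_iff)
      then show False using out k(1) by blast
    qed
    then obtain N where N: "open N" "x \<in> N"
      "N \<subseteq> (\<Union>F\<in>{F \<in> bounded_faces. x \<in> closure F}. closure F)"
      by (rule bounded_faces_nhd)
    have "k \<in> frontier F" if F: "F \<in> bounded_faces" "x \<in> closure F" for F
    proof -
      have "x \<in> frontier F" using bounded_face_closure[OF F(1)] F(2) xD by blast
      then show ?thesis using bounded_face_boundary[OF F(1)] k_on by metis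
    qed
    then have "{F \<in> bounded_faces. x \<in> closure F} \<subseteq> {F \<in> bounded_faces. frontier F \<inter> K \<noteq> {}}"
      using k(1) by auto
    then have "N \<subseteq> W" unfolding W_def by (intro order_trans[OF N(3)] UN_mono) auto
    with N(1,2) show ?thesis by metis
  qed
  have "open (W - ?J)"
  proof (rule topological_space_class.openI)
    fix x assume x: "x \<in> W - ?J"
    then obtain F where F: "F \<in> bounded_faces" "frontier F \<inter> K \<noteq> {}" "x \<in> closure F"
      unfolding W_def by auto
    have "\<exists>N. open N \<and> x \<in> N \<and> N \<subseteq> W"
    proof (cases "x \<in> F")
      case True
      have "closure F \<subseteq> W" unfolding W_def using F(1,2) by (intro UN_upper) simp
      then have "F \<subseteq> W" using closure_subset by (rule order_trans[rotated])
      then show ?thesis using True bounded_face_closure(3)[OF F(1)] by metis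
    next
      case False
      then have xfr: "x \<in> frontier F" using F(3) bounded_face_closure(1)[OF F(1)] by blast
      obtain p q r where pqr: "(p, q) \<in> parcs G" "(q, r) \<in> parcs G" "(r, p) \<in> parcs G"
        and w: "vwalk [p, q, r, p] (with_proj G)"
        and frw: "frontier F = path_image (walk_curve e [p, q, r, p])"
        and fr: "frontier F = edge p q \<union> edge q r \<union> edge r p"
        using bounded_face_boundary[OF F(1)] by metis
      have "K \<inter> {p, q, r} \<noteq> {}"
        using F(2) walk_curve_verts[OF w] K(1) unfolding frw by auto
      then have vert: "s \<in> K \<union> {a, b, c}" if "s \<in> {p, q, r}" for s
        using that nbrs pqr arc_sym by blast
      from xfr obtain s t where st: "(s, t) \<in> parcs G" "x \<in> edge s t" "{s, t} \<subseteq> {p, q, r}"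
        unfolding fr using pqr by blast
      then have st': "s \<in> K \<union> {a, b, c}" "t \<in> K \<union> {a, b, c}" using vert by blast+
      have "edge s t \<subseteq> ?J" if "s \<in> {a, b, c}" "t \<in> {a, b, c}"
        unfolding F0(2) using that arc_neq[OF st(1)] edge_arc(5)[OF arcs(1)]
          edge_arc(5)[OF arcs(2)] edge_arc(5)[OF arcs(3)] by auto
      then have "s \<in> K \<or> t \<in> K" using st' st(2) x by blast
      moreover have "x \<in> K" if "x \<in> {s, t}"
      proof -
        have "{a, b, c} \<subseteq> ?J" unfolding F0(2) using edge_arc(6)[OF arcs(1)]
          edge_arc(6)[OF arcs(2)] edge_arc(6)[OF arcs(3)] by blast
        then show ?thesis using that st' x by blast
      qed
      ultimately show ?thesis using near[of _ x] st(1,2) by blast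
    qed
    then show "\<exists>T. open T \<and> x \<in> T \<and> T \<subseteq> W - ?J"
      using x by (metis DiffD2 DiffI Diff_mono frontier_closed open_Diff order_refl)
  qed
  obtain k where k: "k \<in> K" using K(2) by blast
  have kW: "k \<in> W"
    using near[OF k] by blast
  have "k \<notin> F0" using bounded_face_closure(2)[OF F0(1)] k K(1) unfolding drawn_def by blast
  then have ko: "k \<in> outside ?J"
    using jordan(1) KJ k by (metis IntI UnE ComplI inside_Un_outside emptyE)
  have "outside ?J \<inter> frontier (W - ?J) = {}"
  proof -
    have "closure (W - ?J) \<subseteq> W" using W(1) by (simp add: closure_minimal)
    then have "frontier (W - ?J) \<subseteq> ?J"
      using \<open>open (W - ?J)\<close> by (auto simp: frontier_def interior_open)
    then show ?thesis using outside_no_overlap by blast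
  qed
  then have "outside ?J \<subseteq> W - ?J"
    using connected_Int_frontier[OF jordan(3), of "W - ?J"] kW ko KJ k by blast
  then show False using W(2) jordan(4) bounded_subset by blast
qed

lemma interior_vertex_has_neighbour:
  assumes "v \<in> pverts G" "v \<notin> outer_verts G e"
  obtains u where "(v, u) \<in> parcs G"
proof -
  have vD: "v \<in> drawn G e" unfolding drawn_def using assms(1) by simp
  then have "v \<notin> closure (outside (drawn G e))"
    using closure_outside_drawn assms unfolding outer_verts_def by blast
  then obtain N where "v \<in> N" "N \<subseteq> (\<Union>F\<in>{F \<in> bounded_faces. v \<in> closure F}. closure F)"
    by (rule bounded_faces_nhd)
  then obtain F where F: "F \<in> bounded_faces" "v \<in> closure F" by auto
  then have fr: "v \<in> frontier F" using bounded_face_closure[OF F(1)] vD by auto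
  obtain a b c where arcs: "(a, b) \<in> parcs G" "(b, c) \<in> parcs G" "(c, a) \<in> parcs G"
    and w: "vwalk [a, b, c, a] (with_proj G)" "frontier F = path_image (walk_curve e [a, b, c, a])"
    by (rule bounded_face_boundary[OF F(1)])
  have "v \<in> {a, b, c}" using walk_curve_verts[OF w(1)] fr assms(1) unfolding w(2) by auto
  then show ?thesis using arcs that by auto
qed

section \<open>Winding numbers of walks\<close>

lemma winding_number_adjacent:
  assumes p: "vwalk p (with_proj G)" "hd p = last p"
    and ab: "(a, b) \<in> parcs G" "a \<notin> set p" "b \<notin> set p"
  shows "winding_number (walk_curve e p) a = winding_number (walk_curve e p) b"
proof (rule winding_number_eq)
  show "path (walk_curve e p)" "pathfinish (walk_curve e p) = pathstart (walk_curve e p)"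
    using walk_curve_path[OF p(1)] p(2) by simp_all
  show "a \<in> edge a b" "b \<in> edge a b" "Topological_Spaces.connected (edge a b)"
    using edge_arc[OF ab(1)] by (simp_all add: arc_imp_path connected_path_image)
  show "edge a b \<inter> path_image (walk_curve e p) = {}"
    using edge_avoids_walk_curve p(1) ab by blast
qed

text \<open>
  Points of the outer face are outside every walk, and some of them are arbitrarily close to \<open>a\<close>.
\<close>

lemma winding_number_outer_vert:
  assumes p: "vwalk p (with_proj G)" "hd p = last p"
    and a: "a \<in> outer_verts G e" "a \<notin> set p"
  shows "winding_number (walk_curve e p) a = 0"
proof -
  let ?\<gamma> = "walk_curve e p"
  have path: "path ?\<gamma>" "pathfinish ?\<gamma> = pathstart ?\<gamma>"
    using walk_curve_path[OF p(1)] p(2) by simp_all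
  have aG: "a \<in> pverts G" "a \<in> closure (outside (drawn G e))"
    using a(1) unfolding outer_verts_def frontier_def by auto
  have "a \<notin> path_image ?\<gamma>" using walk_curve_verts[OF p(1)] aG(1) a(2) by blast
  moreover have "open (- path_image ?\<gamma>)" using path(1) by (simp add: closed_path_image open_Compl)
  ultimately obtain \<delta> where \<delta>: "0 < \<delta>" "ball a \<delta> \<subseteq> - path_image ?\<gamma>"
    using open_contains_ball by blast
  then obtain y where y: "y \<in> outside (drawn G e)" "dist y a < \<delta>"
    using aG(2) closure_approachable by blast
  then have "y \<in> outside (path_image ?\<gamma>)"
    using outside_mono[OF walk_curve_drawn[OF p(1)]] by blast
  then have "winding_number ?\<gamma> y = 0" using winding_number_zero_in_outside path by blast
  moreover have "winding_number ?\<gamma> a = winding_number ?\<gamma> y"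
    using path \<delta> y(2) by (intro winding_number_eq[of _ _ "ball a \<delta>"]) (auto simp: dist_commute)
  ultimately show ?thesis by simp
qed

end

section \<open>Planar geometry of discs and directions\<close>

lemma balls_disjoint_imp_dist:
  fixes a b :: "'a :: real_normed_vector"
  assumes "0 < r" "0 < s" "ball a r \<inter> ball b s = {}"
  shows "r + s \<le> dist a b"
proof (rule ccontr)
  assume "\<not> r + s \<le> dist a b"
  then have d: "dist a b < r + s" by simp
  define p where "p = a + (r / (r + s)) *\<^sub>R (b - a)"
  have "b - p = (s / (r + s)) *\<^sub>R (b - a)"
  proof -
    have "b - p = (1 - r / (r + s)) *\<^sub>R (b - a)" unfolding p_def by (simp add: algebra_simps)
    also have "1 - r / (r + s) = s / (r + s)" using assms(1,2) by (simp add: field_simps)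
    finally show ?thesis .
  qed
  then have "dist b p = s / (r + s) * dist a b"
    using assms(1,2) by (simp add: dist_norm norm_minus_commute)
  moreover have "dist a p = r / (r + s) * dist a b"
    unfolding p_def using assms(1,2) by (simp add: dist_norm norm_minus_commute)
  moreover have "r / (r + s) * dist a b < r" "s / (r + s) * dist a b < s"
    using mult_strict_left_mono[OF d, of r] mult_strict_left_mono[OF d, of s] assms(1,2)
    by (simp_all add: field_simps)
  ultimately have "p \<in> ball a r \<inter> ball b s" by simp
  then show False using assms(3) by blast
qed

lemma sphere_in_cball_norm:
  fixes c :: complex
  assumes "0 < r" "sphere c r \<subseteq> cball 0 1"
  shows "norm c + r \<le> 1"
proof -
  \<comment> \<open>The point of the sphere in the direction \<open>d\<close> is at the distance \<open>norm c + r\<close> from the origin.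
    If \<open>c\<close> is the origin, any direction will do.\<close>
  define d where "d = (if c = 0 then 1 else sgn c)"
  have d: "norm d = 1" "c = norm c *\<^sub>R d"
    unfolding d_def by (auto simp: norm_sgn sgn_div_norm)
  have "c + r *\<^sub>R d \<in> sphere c r" using d assms(1) by (simp add: dist_norm)
  then have "norm (c + r *\<^sub>R d) \<le> 1" using assms(2) by auto
  also have "c + r *\<^sub>R d = (norm c + r) *\<^sub>R d" by (subst d(2)) (simp add: algebra_simps)
  finally show ?thesis using d(1) assms(1) by simp
qed

text \<open>
  Stewart's theorem for the point \<open>x\<close> on the segment from \<open>a\<close> to \<open>b\<close> reduces the claim to
  \<open>((1 - u) r - u s)\<^sup>2 \<ge> 0\<close> and \<open>(1 - u) r + u s > 0\<close>.
\<close>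

lemma third_disc_misses_segment:
  fixes a b w :: "'a :: real_inner"
  assumes pos: "0 < r" "0 < s" "0 < t" and ab: "dist a b = r + s"
    and w: "t + r \<le> dist w a" "t + s \<le> dist w b"
    and x: "x \<in> closed_segment a b"
  shows "t < dist w x"
proof -
  obtain u where u: "0 \<le> u" "u \<le> 1" "x = (1 - u) *\<^sub>R a + u *\<^sub>R b"
    using x by (auto simp: in_segment)
  have stewart: "(dist w x)\<^sup>2 = (1 - u) * (dist w a)\<^sup>2 + u * (dist w b)\<^sup>2 - u * (1 - u) * (dist a b)\<^sup>2"
    unfolding u(3) dist_norm power2_norm_eq_inner
    by (simp add: inner_diff_left inner_diff_right inner_add_left inner_add_right
        inner_commute algebra_simps)
  have "(1 - u) * (t + r)\<^sup>2 \<le> (1 - u) * (dist w a)\<^sup>2" "u * (t + s)\<^sup>2 \<le> u * (dist w b)\<^sup>2"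
    using u w pos by (auto intro!: mult_left_mono power_mono)
  then have "(1 - u) * (t + r)\<^sup>2 + u * (t + s)\<^sup>2 - u * (1 - u) * (r + s)\<^sup>2 \<le> (dist w x)\<^sup>2"
    unfolding stewart ab by simp
  moreover have "(1 - u) * (t + r)\<^sup>2 + u * (t + s)\<^sup>2 - u * (1 - u) * (r + s)\<^sup>2
      = t\<^sup>2 + 2 * t * ((1 - u) * r + u * s) + ((1 - u) * r - u * s)\<^sup>2"
    by (simp add: power2_eq_square algebra_simps)
  moreover have "0 < (1 - u) * r + u * s"
    using u pos by (cases "u = 0") (auto intro!: add_nonneg_pos)
  then have "0 < 2 * t * ((1 - u) * r + u * s)" using pos by simp
  ultimately have "t\<^sup>2 < (dist w x)\<^sup>2"
    using zero_le_power2[of "(1 - u) * r - u * s"] by linarith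
  then show ?thesis using power2_less_imp_less zero_le_dist by blast
qed

text \<open>
  The determinant of two plane vectors: it is positive iff \<open>y\<close> follows \<open>x\<close> counterclockwise at an
  angle strictly between \<open>0\<close> and \<open>\<pi>\<close>.
\<close>

definition cross :: "complex \<Rightarrow> complex \<Rightarrow> real" where
  "cross x y = Im (cnj x * y)"

lemma cross_cramer: "cross x z *\<^sub>R y = cross y z *\<^sub>R x + cross x y *\<^sub>R z"
  unfolding cross_def by (simp add: complex_eq_iff algebra_simps)

lemma cross_commute: "cross y x = - cross x y"
  unfolding cross_def by (simp add: algebra_simps)

lemma halfplane_clockwise_extreme:
  assumes S: "finite S" "S \<noteq> {}" "0 \<notin> S" and n: "n \<noteq> 0"
    and half: "\<And>x. x \<in> S \<Longrightarrow> Re (x * cnj n) \<le> 0"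
  obtains b where "b \<in> S" "\<And>x. x \<in> S \<Longrightarrow> 0 \<le> cross b x"
proof -
  \<comment> \<open>The similarity \<open>f\<close> takes the half-plane to the upper half-plane, where the argument orders
    directions from \<open>0\<close> to \<open>\<pi>\<close>.\<close>
  define f where "f x = - \<i> * cnj n * x" for x
  have f: "0 \<le> Im (f x)" "f x \<noteq> 0" if "x \<in> S" for x
    using half[OF that] S(3) n that unfolding f_def by (auto simp: algebra_simps)
  obtain b where b: "b \<in> S" "\<And>x. x \<in> S \<Longrightarrow> Arg (f b) \<le> Arg (f x)"
    using ex_min_if_finite[of "(\<lambda>x. Arg (f x)) ` S"] S(1,2) by (force simp: not_less)
  show ?thesis
  proof
    fix x assume x: "x \<in> S"
    have "0 \<le> Arg (f b)" "Arg (f x) \<le> pi"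
      using f(1)[OF b(1)] Arg_le_pi by (auto simp: Arg_less_0)
    then have "0 \<le> sin (Arg (f x) - Arg (f b))" using b(2)[OF x] by (intro sin_ge_zero) auto
    then have "0 \<le> cmod (f b) * cmod (f x) * sin (Arg (f x) - Arg (f b))" by simp
    also have "\<dots> = Im (cnj (f b) * f x)"
      using rcis_cmod_Arg[of "f b"] rcis_cmod_Arg[of "f x"]
      by (metis Im_rcis cis_cnj mult.assoc rcis_cnj rcis_mult uminus_add_conv_diff)
    also have "\<dots> = (cmod n)\<^sup>2 * cross b x"
      unfolding f_def cross_def cmod_power2 by (simp add: power2_eq_square algebra_simps)
    finally show "0 \<le> cross b x" using n by (simp add: zero_le_mult_iff)
  qed (fact b(1))
qed

section \<open>The maximum principle for circle packings\<close>

locale disc_packing = plane_triangulation G e for G e +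
  fixes cen :: "complex \<Rightarrow> complex" and rad :: "complex \<Rightarrow> real"
  assumes packing_in_disc: "circle_packing_in_disc G e cen rad"
begin

abbreviation center_triangle :: "complex \<Rightarrow> complex \<Rightarrow> complex \<Rightarrow> complex set" where
  "center_triangle a b c \<equiv> convex hull {cen a, cen b, cen c}"

lemma packing: "circle_packing G e cen rad"
  using packing_in_disc by (simp add: circle_packing_in_disc_def)

lemma rad_pos: "v \<in> pverts G \<Longrightarrow> 0 < rad v"
  using packing by (simp add: circle_packing_def)

lemma discs_disjoint:
  assumes "u \<in> pverts G" "v \<in> pverts G" "u \<noteq> v"
  shows "ball (cen u) (rad u) \<inter> ball (cen v) (rad v) = {}"
  using packing assms unfolding circle_packing_def by (elim conjE) simp

lemma dist_cen_ge:
  assumes "u \<in> pverts G" "v \<in> pverts G" "u \<noteq> v"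
  shows "rad u + rad v \<le> dist (cen u) (cen v)"
  using balls_disjoint_imp_dist[OF rad_pos rad_pos discs_disjoint] assms by blast

lemma touching_point:
  assumes "(u, v) \<in> parcs G"
  obtains p where "p \<in> sphere (cen u) (rad u)" "p \<in> sphere (cen v) (rad v)"
proof -
  have "tangent (sphere (cen u) (rad u)) (sphere (cen v) (rad v))"
    using packing assms arc_verts[OF assms] arc_neq[OF assms]
    unfolding circle_packing_def by (elim conjE) simp
  then show ?thesis using that unfolding tangent_def by blast
qed

lemma dist_cen_eq:
  assumes "(u, v) \<in> parcs G"
  shows "dist (cen u) (cen v) = rad u + rad v"
proof (rule antisym)
  show "rad u + rad v \<le> dist (cen u) (cen v)"
    using dist_cen_ge arc_verts[OF assms] arc_neq[OF assms] by blast
  obtain p where "p \<in> sphere (cen u) (rad u)" "p \<in> sphere (cen v) (rad v)"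
    using touching_point[OF assms] .
  then show "dist (cen u) (cen v) \<le> rad u + rad v"
    using dist_triangle[of "cen u" "cen v" p] by (simp add: dist_commute)
qed

lemma norm_cen_le: "v \<in> pverts G \<Longrightarrow> norm (cen v) + rad v \<le> 1"
proof (rule sphere_in_cball_norm)
  assume v: "v \<in> pverts G"
  then show "0 < rad v" by (rule rad_pos)
  show "sphere (cen v) (rad v) \<subseteq> cball 0 1"
  proof (cases "v \<in> outer_verts G e")
    case True
    then have "cball (cen v) (rad v) \<subseteq> cball 0 1"
      using packing_in_disc by (simp add: circle_packing_in_disc_def)
    then show ?thesis using sphere_cball by (rule order_trans[rotated])
  next
    case False
    then have "sphere (cen v) (rad v) \<subseteq> ball 0 1"
      using packing_in_disc v by (simp add: circle_packing_in_disc_def)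
    then show ?thesis using ball_subset_cball by (rule order_trans)
  qed
qed

lemma outer_disc_meets_unit_circle:
  assumes "v \<in> outer_verts G e"
  obtains p where "p \<in> cball (cen v) (rad v)" "norm p = 1"
proof -
  have "tangent (sphere (cen v) (rad v)) (sphere 0 1)"
    using packing_in_disc assms by (simp add: circle_packing_in_disc_def)
  then show ?thesis using that unfolding tangent_def by force
qed

lemma disc_misses_tangent_segment:
  assumes "(a, b) \<in> parcs G" "w \<in> pverts G" "w \<notin> {a, b}"
  shows "cball (cen w) (rad w) \<inter> closed_segment (cen a) (cen b) = {}"
proof -
  note ab = arc_verts[OF assms(1)]
  have "rad w < dist (cen w) x" if "x \<in> closed_segment (cen a) (cen b)" for x
  proof (rule third_disc_misses_segment)
    show "0 < rad a" "0 < rad b" "0 < rad w" using rad_pos ab assms(2) by auto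
    show "dist (cen a) (cen b) = rad a + rad b" using dist_cen_eq assms(1) by blast
    show "rad w + rad a \<le> dist (cen w) (cen a)" "rad w + rad b \<le> dist (cen w) (cen b)"
      using dist_cen_ge ab assms(2,3) by auto
  qed fact
  then show ?thesis by force
qed

text \<open>
  No disc crosses the sides of a triangle of three mutually tangent circles, so a chain of tangent
  discs that starts in a face triangle stays there.  Since a face triangle does not separate, the
  chain reaches an outer vertex, whose circle touches the unit circle, while the triangle is
  contained in the open unit disc.
\<close>

lemma face_triangle_contains_no_center:
  assumes tri: "face_triangle a b c" and w: "w \<in> pverts G" "w \<notin> {a, b, c}"
  shows "cen w \<notin> center_triangle a b c"
proof
  assume wT: "cen w \<in> center_triangle a b c"
  have arcs: "(a, b) \<in> parcs G" "(b, c) \<in> parcs G" "(c, a) \<in> parcs G"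
    using tri unfolding face_triangle_def boundary_triangle_def by auto
  have stays: "cball (cen k) (rad k) \<subseteq> center_triangle a b c"
    if k: "k \<in> pverts G - {a, b, c}" "cball (cen k) (rad k) \<inter> center_triangle a b c \<noteq> {}" for k
  proof (rule ccontr)
    assume "\<not> cball (cen k) (rad k) \<subseteq> center_triangle a b c"
    then have "cball (cen k) (rad k) \<inter> frontier (center_triangle a b c) \<noteq> {}"
      using connected_Int_frontier[OF connected_cball k(2)] by blast
    moreover have "frontier (center_triangle a b c) = closed_segment (cen a) (cen b) \<union>
        closed_segment (cen b) (cen c) \<union> closed_segment (cen c) (cen a)"
      by (rule frontier_of_triangle) simp
    ultimately show False
      using disc_misses_tangent_segment[OF arcs(1), of k]
        disc_misses_tangent_segment[OF arcs(2), of k]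
        disc_misses_tangent_segment[OF arcs(3), of k] k(1) by auto
  qed
  define K where "K = {k \<in> pverts G - {a, b, c}. cball (cen k) (rad k) \<subseteq> center_triangle a b c}"
  have "cen w \<in> cball (cen w) (rad w)" using rad_pos[OF w(1)] by simp
  then have "w \<in> K"
    unfolding K_def using stays[of w] w wT by blast
  have "K \<inter> outer_verts G e \<noteq> {}"
  proof (rule face_triangle_not_separating[OF tri])
    fix k u assume k: "k \<in> K" and ku: "(k, u) \<in> parcs G"
    have "cball (cen k) (rad k) \<inter> cball (cen u) (rad u) \<noteq> {}"
    proof -
      obtain p where "p \<in> sphere (cen k) (rad k)" "p \<in> sphere (cen u) (rad u)"
        using touching_point[OF ku] .
      then have "p \<in> cball (cen k) (rad k) \<inter> cball (cen u) (rad u)" by simp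
      then show ?thesis by blast
    qed
    moreover have "cball (cen k) (rad k) \<subseteq> center_triangle a b c"
      using k unfolding K_def by simp
    ultimately have "cball (cen u) (rad u) \<inter> center_triangle a b c \<noteq> {}" by blast
    then show "u \<in> K \<union> {a, b, c}"
      using stays[of u] arc_verts(2)[OF ku] unfolding K_def by auto
  qed (use \<open>w \<in> K\<close> in \<open>auto simp: K_def\<close>)
  then obtain o' where o': "o' \<in> outer_verts G e" "cball (cen o') (rad o') \<subseteq> center_triangle a b c"
    unfolding K_def by blast
  have "cen v \<in> ball 0 1" if "v \<in> {a, b, c}" for v
    using norm_cen_le[of v] rad_pos[of v] arc_verts[OF arcs(1)] arc_verts[OF arcs(2)] that by force
  then have "center_triangle a b c \<subseteq> ball 0 1" by (intro hull_minimal) auto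
  moreover obtain p where "p \<in> cball (cen o') (rad o')" "norm p = 1"
    using outer_disc_meets_unit_circle[OF o'(1)] .
  ultimately have "p \<in> ball 0 1" using o'(2) by blast
  then show False using \<open>norm p = 1\<close> by simp
qed

text \<open>
  If the vectors from \<open>v\<close> to \<open>w\<close> and \<open>u\<close> are parallel, the distance of \<open>w\<close> and \<open>u\<close> is the
  difference or the sum of their lengths.  The difference is \<open>\<bar>rad w - rad u\<bar>\<close>, too small for disjoint discs, and the sum exceeds
  \<open>rad w + rad u\<close> by \<open>2 rad v\<close>, too much for tangent circles.
\<close>

lemma tangent_directions:
  assumes vw: "(v, w) \<in> parcs G" and vu: "(v, u) \<in> parcs G" and "w \<noteq> u"
    and par: "cross (cen w - cen v) (cen u - cen v) = 0"
  shows "Re (cnj (cen w - cen v) * (cen u - cen v)) < 0" "(w, u) \<notin> parcs G"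
proof -
  define x y where "x = cen w - cen v" and "y = cen u - cen v"
  have pos: "0 < rad v" "0 < rad w" "0 < rad u" using rad_pos arc_verts[OF vw] arc_verts[OF vu] by auto
  have x: "norm x = rad v + rad w" and y: "norm y = rad v + rad u"
    unfolding x_def y_def using dist_cen_eq[OF vw] dist_cen_eq[OF vu]
    by (simp_all add: dist_norm norm_minus_commute)
  have xy: "dist (cen w) (cen u) = norm (x - y)" unfolding x_def y_def by (simp add: dist_norm)
  have ge: "rad w + rad u \<le> norm (x - y)"
    using dist_cen_ge arc_verts[OF vw] arc_verts[OF vu] \<open>w \<noteq> u\<close> xy by metis
  have expand: "(norm (x - y))\<^sup>2 = (norm x)\<^sup>2 + (norm y)\<^sup>2 - 2 * Re (cnj x * y)"
    unfolding cmod_power2 by (simp add: power2_eq_square algebra_simps)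
  have "(Re (cnj x * y))\<^sup>2 + (cross x y)\<^sup>2 = (norm (cnj x * y))\<^sup>2"
    unfolding cross_def by (rule cmod_power2[symmetric])
  then have "(Re (cnj x * y))\<^sup>2 = (norm x * norm y)\<^sup>2"
    using par unfolding x_def[symmetric] y_def[symmetric] by (simp add: norm_mult)
  then have "Re (cnj x * y) = norm x * norm y \<or> Re (cnj x * y) = - (norm x * norm y)"
    by (simp add: power2_eq_iff)
  moreover have "Re (cnj x * y) \<noteq> norm x * norm y"
  proof
    assume "Re (cnj x * y) = norm x * norm y"
    then have "(norm (x - y))\<^sup>2 = (rad w - rad u)\<^sup>2"
      unfolding expand x y by (simp add: power2_eq_square algebra_simps)
    then have "norm (x - y) = \<bar>rad w - rad u\<bar>" by (metis abs_norm_cancel real_sqrt_abs)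
    then show False using ge pos by linarith
  qed
  ultimately have neg: "Re (cnj x * y) = - (norm x * norm y)" by blast
  then show "Re (cnj (cen w - cen v) * (cen u - cen v)) < 0"
    unfolding x_def[symmetric] y_def[symmetric] using x y pos by simp
  have "(norm (x - y))\<^sup>2 = (norm x + norm y)\<^sup>2"
    unfolding expand neg by (simp add: power2_eq_square algebra_simps)
  then have "norm (x - y) = norm x + norm y" by simp
  then show "(w, u) \<notin> parcs G" using dist_cen_eq[of w u] xy x y pos by auto
qed

text \<open>
  If the center of \<open>w\<close> is in the angle of the face at \<open>v\<close>, then it is in the face triangle, where
  there is no other center, or the segment from \<open>v\<close> to \<open>w\<close> crosses the opposite side, which neither of the discs of \<open>v\<close> and \<open>w\<close> meets.
\<close>

lemma no_neighbour_in_face_angle: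
  assumes tri: "face_triangle v b c" and vw: "(v, w) \<in> parcs G" "w \<notin> {b, c}"
    and cone: "0 \<le> \<alpha>" "0 \<le> \<beta>" "cen w - cen v = \<alpha> *\<^sub>R (cen b - cen v) + \<beta> *\<^sub>R (cen c - cen v)"
  shows False
proof (cases "\<alpha> + \<beta> \<le> 1")
  case True
  have "cen w = (1 - \<alpha> - \<beta>) *\<^sub>R cen v + \<alpha> *\<^sub>R cen b + \<beta> *\<^sub>R cen c"
    using cone(3) by (simp add: algebra_simps)
  then have "cen w \<in> center_triangle v b c"
    unfolding convex_hull_3 using True cone(1,2)
    by (intro CollectI exI[of _ "1 - \<alpha> - \<beta>"] exI[of _ \<alpha>] exI[of _ \<beta>]) auto
  then show False
    using face_triangle_contains_no_center[OF tri arc_verts(2)[OF vw(1)]] vw arc_neq by blast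
next
  case False
  define s where "s = \<alpha> + \<beta>"
  have s: "1 < s" using False unfolding s_def by simp
  define y where "y = cen v + (1 / s) *\<^sub>R (cen w - cen v)"
  have bc: "(b, c) \<in> parcs G" "v \<notin> {b, c}"
    using tri unfolding face_triangle_def boundary_triangle_def by auto
  have "\<alpha> / s + \<beta> / s = 1" using s unfolding s_def by (simp flip: add_divide_distrib)
  then have as: "\<alpha> / s = 1 - \<beta> / s" by simp
  have "y = cen v + (\<alpha> / s) *\<^sub>R (cen b - cen v) + (\<beta> / s) *\<^sub>R (cen c - cen v)"
    unfolding y_def cone(3) by (simp add: scaleR_add_right)
  also have "\<dots> = (1 - \<beta> / s) *\<^sub>R cen b + (\<beta> / s) *\<^sub>R cen c"
    unfolding as by (simp add: algebra_simps)
  finally have y_bc: "y \<in> closed_segment (cen b) (cen c)"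
    unfolding in_segment using s cone(1,2) s_def
    by (intro exI[of _ "\<beta> / s"]) (auto simp: field_simps)
  have "dist (cen v) y = (1 / s) * dist (cen v) (cen w)"
    unfolding y_def using s by (simp add: dist_norm norm_minus_commute)
  moreover have "dist (cen w) y = (1 - 1 / s) * dist (cen v) (cen w)"
  proof -
    have "cen w - y = (1 - 1 / s) *\<^sub>R (cen w - cen v)" unfolding y_def by (simp add: algebra_simps)
    then show ?thesis using s by (simp add: dist_norm norm_minus_commute)
  qed
  ultimately have "dist (cen v) y + dist (cen w) y = rad v + rad w"
    using dist_cen_eq[OF vw(1)] by (simp add: algebra_simps)
  then have "y \<in> cball (cen v) (rad v) \<or> y \<in> cball (cen w) (rad w)"
    unfolding mem_cball by linarith
  then show False
    using disc_misses_tangent_segment[OF bc(1)] arc_verts[OF vw(1)] bc(2) vw(2) y_bc by blast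
qed

text \<open>
  If all neighbours were in a closed half-plane through the center of \<open>v\<close>, take the first of them in
  counterclockwise order.  Its edge to \<open>v\<close> lies in two faces, whose third vertices both follow it
  counterclockwise within an angle less than \<open>\<pi>\<close>, so one of them is inside the angle of the
  other face.
\<close>

lemma interior_vertex_neighbour_beyond:
  assumes v: "v \<in> pverts G" "v \<notin> outer_verts G e" and n: "n \<noteq> 0"
  obtains w where "(v, w) \<in> parcs G" "0 < Re ((cen w - cen v) * cnj n)"
proof (rule ccontr)
  assume "\<not> thesis"
  then have half: "Re ((cen w - cen v) * cnj n) \<le> 0" if "(v, w) \<in> parcs G" for w
    using that \<open>\<And>w. (v, w) \<in> parcs G \<Longrightarrow> 0 < Re ((cen w - cen v) * cnj n) \<Longrightarrow> thesis\<close>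
    by (meson not_le)
  let ?d = "\<lambda>w. cen w - cen v"
  let ?S = "?d ` {w. (v, w) \<in> parcs G}"
  have fin: "finite {w. (v, w) \<in> parcs G}"
    using graph.pair_finite_verts arc_verts(2) by (rule_tac finite_subset) auto
  have nz: "?d w \<noteq> 0" if "(v, w) \<in> parcs G" for w
    using dist_cen_eq[OF that] rad_pos[OF arc_verts(1)[OF that]] rad_pos[OF arc_verts(2)[OF that]]
    by auto
  obtain u where "(v, u) \<in> parcs G" using interior_vertex_has_neighbour[OF v] .
  then have ne: "?S \<noteq> {}" by auto
  have z: "0 \<notin> ?S" using nz by auto
  have halfS: "Re (x * cnj n) \<le> 0" if "x \<in> ?S" for x
    using half that by blast
  obtain x where x: "x \<in> ?S" "\<And>y. y \<in> ?S \<Longrightarrow> 0 \<le> cross x y"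
    using halfplane_clockwise_extreme[OF finite_imageI[OF fin] ne z n halfS] by blast
  then obtain b where b: "(v, b) \<in> parcs G" "x = ?d b" by auto
  have ext: "0 \<le> cross (?d b) (?d w)" if "(v, w) \<in> parcs G" for w
    using x(2)[of "?d w"] that b(2) by auto
  obtain c c' where cc: "c \<noteq> c'" "face_triangle v b c" "face_triangle v b c'"
    using interior_edge_two_faces[OF b(1) v(2)] .
  have arcs: "(v, t) \<in> parcs G" "b \<noteq> t" "(b, t) \<in> parcs G" if "face_triangle v b t" for t
    using that arc_sym unfolding face_triangle_def boundary_triangle_def by auto
  have pos: "0 < cross (?d b) (?d t)" if "face_triangle v b t" for t
    using tangent_directions(2)[OF b(1) arcs(1,2)[OF that]] arcs(3)[OF that] ext[OF arcs(1)[OF that]]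
    by force
  have no: "\<not> 0 < cross (?d s) (?d t)"
    if "s \<noteq> t" and s: "face_triangle v b s" and t: "face_triangle v b t" for s t
  proof
    assume st: "0 < cross (?d s) (?d t)"
    have "?d s = (cross (?d s) (?d t) / cross (?d b) (?d t)) *\<^sub>R ?d b
        + (cross (?d b) (?d s) / cross (?d b) (?d t)) *\<^sub>R ?d t"
    proof -
      have "cross (?d b) (?d t) *\<^sub>R ?d s = cross (?d b) (?d t) *\<^sub>R
        ((cross (?d s) (?d t) / cross (?d b) (?d t)) *\<^sub>R ?d b
        + (cross (?d b) (?d s) / cross (?d b) (?d t)) *\<^sub>R ?d t)"
        using pos[OF t] cross_cramer[of "?d b" "?d t" "?d s"] by (simp add: scaleR_add_right)
      then show ?thesis using pos[OF t] by (metis less_irrefl scaleR_left_imp_eq)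
    qed
    then show False
      using no_neighbour_in_face_angle[OF t arcs(1)[OF s]] \<open>s \<noteq> t\<close> arcs(2)[OF s] st pos[OF s] pos[OF t]
      by (metis divide_nonneg_nonneg insertE less_imp_le singletonD)
  qed
  have "cross (?d c) (?d c') = 0"
    using no[OF cc] no[OF cc(1)[symmetric] cc(3,2)] cross_commute[of "?d c" "?d c'"] by linarith
  then have neg: "Re (cnj (?d c) * ?d c') < 0"
    and par: "cross (?d b) (?d c') *\<^sub>R ?d c = cross (?d b) (?d c) *\<^sub>R ?d c'"
    using tangent_directions(1)[OF arcs(1)[OF cc(2)] arcs(1)[OF cc(3)] cc(1)]
      cross_cramer[of "?d b" "?d c'" "?d c"] by auto
  have scale: "Re (cnj x * (r *\<^sub>R y)) = r * Re (cnj x * y)" for x y :: complex and r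
    by (simp add: algebra_simps)
  have sq: "0 \<le> Re (cnj x * x)" for x by simp
  have "0 \<le> cross (?d b) (?d c') * Re (cnj (?d c) * ?d c)"
    using pos[OF cc(3)] by (intro mult_nonneg_nonneg sq) simp
  also have "\<dots> = cross (?d b) (?d c) * Re (cnj (?d c) * ?d c')"
    using arg_cong[OF par, of "\<lambda>y. Re (cnj (?d c) * y)"] unfolding scale .
  also have "\<dots> < 0" using pos[OF cc(2)] neg by (rule mult_pos_neg)
  finally show False by simp
qed

text \<open>
  The vertices off the walk at which its winding number is not zero are interior vertices, and their
  neighbours are of the same kind or on the walk.  The one whose center is extreme in the direction
  \<open>n\<close> has a neighbour that is further in this direction, which is therefore on the walk.
\<close>

lemma winding_walk_crosses_halfplane:
  assumes p: "vwalk p (with_proj G)" "hd p = last p"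
    and \<rho>: "\<rho> \<in> pverts G" "\<rho> \<notin> set p" "winding_number (walk_curve e p) \<rho> \<noteq> 0" and n: "n \<noteq> 0"
  obtains u where "u \<in> set p" "0 < Re ((cen u - cen \<rho>) * cnj n)"
proof -
  define A where "A = {a \<in> pverts G - set p. winding_number (walk_curve e p) a \<noteq> 0}"
  define f where "f a = Re (cen a * cnj n)" for a
  have "finite A" "\<rho> \<in> A" unfolding A_def using graph.pair_finite_verts \<rho> by auto
  then obtain a where a: "a \<in> A" and max: "\<And>b. b \<in> A \<Longrightarrow> f b \<le> f a"
    using Max_in[of "f ` A"] Max_ge[of "f ` A"] by (metis empty_iff finite_imageI image_iff image_is_empty)
  have "a \<in> pverts G" "a \<notin> outer_verts G e"
    using a winding_number_outer_vert[OF p] unfolding A_def by auto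
  then obtain w where w: "(a, w) \<in> parcs G" "0 < Re ((cen w - cen a) * cnj n)"
    using interior_vertex_neighbour_beyond n by blast
  then have fw: "f a < f w" unfolding f_def by (simp add: algebra_simps)
  have "w \<in> set p"
  proof (rule ccontr)
    assume "w \<notin> set p"
    then have "w \<in> A"
      using winding_number_adjacent[OF p w(1)] a arc_verts[OF w(1)] unfolding A_def by auto
    then show False using max fw by force
  qed
  moreover have "0 < Re ((cen w - cen \<rho>) * cnj n)"
    using max[OF \<open>\<rho> \<in> A\<close>] fw unfolding f_def by (simp add: algebra_simps)
  ultimately show ?thesis using that by blast
qed

end

section \<open>Lower bounds for vertex extremal length\<close>

lemma VEL_ge:
  assumes V: "finite V" and m: "\<And>v. v \<in> V \<Longrightarrow> 0 \<le> m v" "w \<in> V" "0 < m w"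
    and L: "0 \<le> L" "\<And>p. p \<in> \<Gamma> \<Longrightarrow> L \<le> len m p"
    and A: "area V m \<le> A"
  shows "ereal (L\<^sup>2 / A) \<le> VEL V \<Gamma>"
proof -
  have "0 < (m w)\<^sup>2" using m(3) by simp
  also have "\<dots> \<le> area V m"
    unfolding area_def using V m(2) by (intro member_le_sum) auto
  finally have pos: "0 < area V m" .
  have "ereal L \<le> (INF p\<in>\<Gamma>. ereal (len m p))"
    using L(2) by (intro INF_greatest) simp
  then have "(ereal L)\<^sup>2 \<le> (INF p\<in>\<Gamma>. ereal (len m p))\<^sup>2"
    using L(1) unfolding power2_eq_square by (intro ereal_mult_mono') auto
  have "ereal (L\<^sup>2 / A) \<le> ereal (L\<^sup>2 / area V m)"
    using A pos by (simp add: frac_le)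
  also have "\<dots> = (ereal L)\<^sup>2 / ereal (area V m)"
    using pos by simp
  also have "\<dots> \<le> (INF p\<in>\<Gamma>. ereal (len m p))\<^sup>2 / ereal (area V m)"
    using \<open>(ereal L)\<^sup>2 \<le> _\<close> pos by (intro ereal_divide_right_mono) auto
  also have "\<dots> \<le> VEL V \<Gamma>"
    unfolding VEL_def using m by (intro SUP_upper) force
  finally show ?thesis .
qed

text \<open>
  In the telescoping sum an inner vertex of the path takes part in two increments, and each end
  vertex in one.
\<close>

lemma vpath_increment_le:
  fixes f m :: "'a \<Rightarrow> real"
  assumes p: "vpath p G" and step: "\<And>a b. (a, b) \<in> arcs_ends G \<Longrightarrow> f b - f a \<le> m a + m b"
  shows "f (last p) - f (hd p) \<le> 2 * (\<Sum>v\<in>set p. m v) - m (hd p) - m (last p)"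
proof -
  have "vwalk p G" "distinct p" using p by (auto simp: vpath_def)
  then show ?thesis
  proof (induction p rule: vwalk_induct)
    case (Base u)
    then show ?case by simp
  next
    case (Cons u v es)
    then show ?case using step[OF Cons.hyps] by simp
  qed
qed

lemma vwalk_increment_le:
  fixes f m :: "'a \<Rightarrow> real"
  assumes p: "vwalk p G" and u: "u \<in> set p" and m: "\<And>v. v \<in> set p \<Longrightarrow> 0 \<le> m v"
    and step: "\<And>a b. (a, b) \<in> arcs_ends G \<Longrightarrow> f b - f a \<le> m a + m b"
  shows "f u - f (hd p) \<le> 2 * (\<Sum>v\<in>set p. m v)"
proof -
  obtain xs ys where split: "p = (xs @ [u]) @ ys" using split_list[OF u] by auto
  define q where "q = vwalk_to_vpath (xs @ [u])"
  have w: "vwalk (xs @ [u]) G" using p vwalkI_append_l[of "xs @ [u]" ys G] unfolding split by simp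
  have q: "vpath q G" "hd q = hd p" "last q = u" "set q \<subseteq> set p"
    unfolding q_def using vwalk_to_vpath_vpath[OF w] split vwalk_to_vpath_subset[of _ "xs @ [u]"]
    by (auto simp: vwalk_to_vpath_hd vwalk_to_vpath_last hd_append)
  have "q \<noteq> []" using q(1) by (auto simp: vpath_def vwalk_def)
  then have "hd q \<in> set p" "last q \<in> set p" using q(4) by auto
  then have "f u - f (hd p) \<le> 2 * (\<Sum>v\<in>set q. m v)"
    using vpath_increment_le[of q G f m, OF q(1) step] m[of "hd q"] m[of "last q"]
    unfolding q(2,3) by simp
  also have "\<dots> \<le> 2 * (\<Sum>v\<in>set p. m v)"
    using q(4) m by (intro mult_left_mono sum_mono2) auto
  finally show ?thesis .
qed

lemma sum_squares_disjoint_balls_le: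
  fixes c :: "'a \<Rightarrow> complex"
  assumes "finite V" "0 \<le> R"
    and "\<And>v. v \<in> V \<Longrightarrow> 0 < r v \<and> ball (c v) (r v) \<subseteq> ball z R"
    and "\<And>u v. u \<in> V \<Longrightarrow> v \<in> V \<Longrightarrow> u \<noteq> v \<Longrightarrow> ball (c u) (r u) \<inter> ball (c v) (r v) = {}"
  shows "(\<Sum>v\<in>V. (r v)\<^sup>2) \<le> R\<^sup>2"
proof -
  have "(\<Sum>v\<in>V. measure lebesgue (ball (c v) (r v))) = measure lebesgue (\<Union>v\<in>V. ball (c v) (r v))"
    using assms by (intro measure_UNION'[symmetric]) (auto simp: pairwise_def disjnt_def)
  also have "\<dots> \<le> measure lebesgue (ball z R)"
    using assms by (intro measure_mono_fmeasurable) auto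
  finally have "(\<Sum>v\<in>V. pi * (r v)\<^sup>2) \<le> pi * R\<^sup>2"
    using assms by (simp add: content_ball unit_ball_vol_2 less_imp_le)
  then show ?thesis by (simp flip: sum_distrib_left)
qed

text \<open>
  The number \<open>\<kappa> v\<close> is the index of the dyadic annulus around \<open>z\<close> in which the center of the disc is,
  where index \<open>1\<close> also takes the points within \<open>2 \<epsilon>\<close> of \<open>z\<close>.  The disjoint discs of index \<open>k\<close> are in a
  ball of radius \<open>3 * 2 ^ k * \<epsilon>\<close>, so the sum of the squares of their radii is at most
  \<open>9 * (2 ^ k * \<epsilon>)\<^sup>2\<close>, and the weights are at most \<open>2 / (2 ^ k * \<epsilon>)\<close> times the radii.
\<close>

lemma area_log_metric_le:
  fixes c :: "'a \<Rightarrow> complex"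
  assumes V: "finite V" and eps: "\<And>v. v \<in> V \<Longrightarrow> 0 < r v \<and> r v \<le> \<epsilon>" "0 < \<epsilon>"
    and disj: "\<And>u v. u \<in> V \<Longrightarrow> v \<in> V \<Longrightarrow> u \<noteq> v \<Longrightarrow> ball (c u) (r u) \<inter> ball (c v) (r v) = {}"
    and N: "2 \<le> N" "\<And>v. v \<in> V \<Longrightarrow> dist (c v) z < 2 ^ N * \<epsilon>"
  shows "(\<Sum>v\<in>V. (2 * r v / max (dist (c v) z) (2 * \<epsilon>))\<^sup>2) \<le> 36 * real N"
proof -
  define D where "D v = max (dist (c v) z) (2 * \<epsilon>)" for v
  define \<kappa> where "\<kappa> v = (LEAST k. D v < 2 ^ Suc k * \<epsilon>)" for v
  have "(2::real) ^ 2 \<le> 2 ^ N" using N(1) by (intro power_increasing) auto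
  then have "2 * \<epsilon> < 2 ^ N * \<epsilon>" using eps(2) by (intro mult_strict_right_mono) auto
  then have DN: "D v < 2 ^ Suc (N - 1) * \<epsilon>" if "v \<in> V" for v
    unfolding D_def using N that by simp
  have \<kappa>: "\<kappa> v < N" "D v < 2 ^ Suc (\<kappa> v) * \<epsilon>" "2 ^ \<kappa> v * \<epsilon> \<le> D v" if v: "v \<in> V" for v
  proof -
    have "\<kappa> v \<le> N - 1" unfolding \<kappa>_def using DN[OF v] by (rule Least_le)
    then show "\<kappa> v < N" using N(1) by simp
    show "D v < 2 ^ Suc (\<kappa> v) * \<epsilon>" unfolding \<kappa>_def using DN[OF v] by (rule LeastI)
    show "2 ^ \<kappa> v * \<epsilon> \<le> D v"
    proof (cases "\<kappa> v")
      case 0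
      then show ?thesis using eps(2) unfolding D_def by simp
    next
      case (Suc k)
      then have "\<not> D v < 2 ^ Suc k * \<epsilon>"
        unfolding \<kappa>_def by (metis lessI not_less_Least)
      then show ?thesis using Suc by simp
    qed
  qed
  have Dpos: "0 < D v" for v unfolding D_def using eps(2) by simp
  have annulus: "(\<Sum>v\<in>{v \<in> V. \<kappa> v = k}. (2 * r v / D v)\<^sup>2) \<le> 36" for k
  proof -
    let ?A = "{v \<in> V. \<kappa> v = k}" and ?s = "2 ^ k * \<epsilon>"
    have s: "\<epsilon> \<le> ?s" "0 < ?s" using eps(2) by simp_all
    have "(2 * r v / D v)\<^sup>2 \<le> 4 / ?s\<^sup>2 * (r v)\<^sup>2" if v: "v \<in> ?A" for v
    proof -
      have "2 * r v / D v \<le> 2 * r v / ?s"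
        using \<kappa>(3)[of v] v eps(1)[of v] s Dpos by (intro divide_left_mono) auto
      moreover have "0 \<le> 2 * r v / D v"
        using v eps(1)[of v] Dpos[of v] by auto
      ultimately have "(2 * r v / D v)\<^sup>2 \<le> (2 * r v / ?s)\<^sup>2" by (intro power_mono)
      then show ?thesis by (simp add: power_divide power_mult_distrib)
    qed
    then have "(\<Sum>v\<in>?A. (2 * r v / D v)\<^sup>2) \<le> 4 / ?s\<^sup>2 * (\<Sum>v\<in>?A. (r v)\<^sup>2)"
      unfolding sum_distrib_left by (rule sum_mono)
    also have "\<dots> \<le> 4 / ?s\<^sup>2 * (3 * ?s)\<^sup>2"
    proof (intro mult_left_mono sum_squares_disjoint_balls_le)
      fix v assume v: "v \<in> ?A"
      then have "dist (c v) z < 2 * ?s" using \<kappa>(2)[of v] unfolding D_def by auto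
      moreover have "r v \<le> ?s" using v eps(1)[of v] order_trans[OF _ s(1)] by blast
      ultimately have "dist (c v) z + r v \<le> 3 * ?s" by linarith
      then show "0 < r v \<and> ball (c v) (r v) \<subseteq> ball z (3 * ?s)"
        using eps(1)[of v] v by (simp add: ball_subset_ball_iff)
    qed (use V s disj in auto)
    also have "4 / ?s\<^sup>2 * (3 * ?s)\<^sup>2 = 36" using eps(2) by (simp add: power_mult_distrib)
    finally show ?thesis .
  qed
  have "(\<Sum>v\<in>V. (2 * r v / D v)\<^sup>2) = (\<Sum>k<N. \<Sum>v\<in>{v \<in> V. \<kappa> v = k}. (2 * r v / D v)\<^sup>2)"
    using V \<kappa>(1) by (intro sum.group[symmetric]) auto
  also have "\<dots> \<le> (\<Sum>k<N. 36)" by (intro sum_mono annulus)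
  finally show ?thesis unfolding D_def by simp
qed

text \<open>
  The bound \<open>ln t \<le> t - 1\<close> gives the increment \<open>(r + s) / A\<close>.  Cutting the distance off at \<open>2 \<epsilon>\<close>
  ensures that \<open>B \<le> 2 A\<close>, which allows the share of \<open>s\<close> to be measured on the scale of \<open>b\<close>.
\<close>

lemma ln_increment_tangent_le:
  fixes a b z :: "'a :: metric_space"
  assumes eps: "0 < r" "r \<le> \<epsilon>" "0 < s" "s \<le> \<epsilon>" and ab: "dist a b = r + s"
  shows "ln (max (dist b z) (2 * \<epsilon>)) - ln (max (dist a z) (2 * \<epsilon>))
    \<le> 2 * r / max (dist a z) (2 * \<epsilon>) + 2 * s / max (dist b z) (2 * \<epsilon>)"
proof -
  define A B where "A = max (dist a z) (2 * \<epsilon>)" and "B = max (dist b z) (2 * \<epsilon>)"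
  have pos: "2 * \<epsilon> \<le> A" "2 * \<epsilon> \<le> B" "0 < A" "0 < B" unfolding A_def B_def using eps by auto
  have BA: "B \<le> A + (r + s)"
    unfolding A_def B_def using dist_triangle[of b z a] ab eps by (auto simp: dist_commute)
  have "ln B - ln A = ln (B / A)" using pos by (simp add: ln_div)
  also have "\<dots> \<le> B / A - 1" using pos by (intro ln_le_minus_one) simp
  also have "\<dots> \<le> (r + s) / A"
    using divide_right_mono[OF BA, of A] pos by (simp add: add_divide_distrib)
  also have "\<dots> = r / A + s / A" by (simp add: add_divide_distrib)
  also have "s / A \<le> 2 * s / B"
  proof -
    have "B \<le> 2 * A" using BA eps pos by linarith
    then show ?thesis using pos eps mult_left_mono[of B "2 * A" s] by (simp add: field_simps)
  qed
  also have "r / A \<le> 2 * r / A" using pos eps by (simp add: field_simps)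
  finally show ?thesis unfolding A_def B_def by simp
qed

section \<open>Extremal length in a packing by small circles\<close>

context disc_packing
begin

lemma VEL_walks_reaching_ge:
  assumes v: "v \<in> pverts G" and eps: "0 < \<epsilon>" "\<And>u. u \<in> pverts G \<Longrightarrow> rad u \<le> \<epsilon>"
    and N: "2 \<le> N" "2 \<le> 2 ^ N * \<epsilon>" and R: "2 * \<epsilon> \<le> R"
    and \<Gamma>: "\<And>p. p \<in> \<Gamma> \<Longrightarrow> vwalk p (with_proj G) \<and> hd p = v \<and> (\<exists>u\<in>set p. R \<le> dist (cen u) (cen v))"
  shows "ereal ((ln (R / (2 * \<epsilon>)) / 2)\<^sup>2 / (36 * real N)) \<le> VEL (pverts G) \<Gamma>"
proof (rule VEL_ge)
  define D where "D u = max (dist (cen u) (cen v)) (2 * \<epsilon>)" for u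
  define m where "m u = 2 * rad u / D u" for u
  have D: "0 < D u" for u unfolding D_def using eps(1) by simp
  have m_pos: "0 < m u" if "u \<in> pverts G" for u unfolding m_def using D rad_pos[OF that] by simp
  show "finite (pverts G)" by (rule graph.pair_finite_verts)
  show "0 \<le> m u" if "u \<in> pverts G" for u using m_pos[OF that] by simp
  show "v \<in> pverts G" "0 < m v" using v m_pos by auto
  show "0 \<le> ln (R / (2 * \<epsilon>)) / 2" using R eps(1) by simp
  show "ln (R / (2 * \<epsilon>)) / 2 \<le> len m p" if "p \<in> \<Gamma>" for p
  proof -
    have p: "vwalk p (with_proj G)" "hd p = v" "\<exists>u\<in>set p. R \<le> dist (cen u) (cen v)"
      using \<Gamma>[OF that] by auto
    then obtain u where u: "u \<in> set p" "R \<le> dist (cen u) (cen v)" by auto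
    have "ln (D u) - ln (D (hd p)) \<le> 2 * (\<Sum>w\<in>set p. m w)"
    proof (rule vwalk_increment_le[OF p(1) u(1)])
      show "0 \<le> m w" if "w \<in> set p" for w
        using that p(1) m_pos[of w] unfolding vwalk_def by auto
      show "ln (D b) - ln (D a) \<le> m a + m b" if "(a, b) \<in> arcs_ends (with_proj G)" for a b
      proof -
        have ab: "(a, b) \<in> parcs G" using that by simp
        show ?thesis
          unfolding D_def m_def using rad_pos eps(2) arc_verts[OF ab] dist_cen_eq[OF ab]
          by (intro ln_increment_tangent_le) auto
      qed
    qed
    moreover have "ln R \<le> ln (D u)"
      using u(2) R eps(1) D[of u] unfolding D_def by (subst ln_le_cancel_iff) auto
    moreover have "D (hd p) = 2 * \<epsilon>" unfolding p(2) D_def using eps(1) by simp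
    moreover have "ln (R / (2 * \<epsilon>)) = ln R - ln (2 * \<epsilon>)" using R eps(1) by (simp add: ln_div)
    ultimately show ?thesis unfolding len_def by simp
  qed
  show "area (pverts G) m \<le> 36 * real N"
    unfolding area_def m_def D_def
  proof (rule area_log_metric_le)
    fix u assume u: "u \<in> pverts G"
    show "0 < rad u \<and> rad u \<le> \<epsilon>" using rad_pos eps(2) u by simp
    have "dist (cen u) (cen v) \<le> norm (cen u) + norm (cen v)"
      by (metis dist_norm norm_triangle_ineq4)
    also have "\<dots> < 2" using norm_cen_le[OF u] norm_cen_le[OF v] rad_pos[OF u] rad_pos[OF v] by linarith
    finally show "dist (cen u) (cen v) < 2 ^ N * \<epsilon>" using N(2) by simp
  qed (rule graph.pair_finite_verts eps(1) N(1) discs_disjoint; assumption?)+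
qed

lemma VEL_walks_from_ge_1:
  assumes v: "v \<in> pverts G"
    and \<Gamma>: "\<And>p. p \<in> \<Gamma> \<Longrightarrow> vwalk p (with_proj G) \<and> hd p = v"
  shows "1 \<le> VEL (pverts G) \<Gamma>"
proof -
  define m where "m = (\<lambda>u. if u = v then 1 else 0 :: real)"
  have "ereal (1\<^sup>2 / 1) \<le> VEL (pverts G) \<Gamma>"
  proof (rule VEL_ge[of _ m v])
    show "1 \<le> len m p" if "p \<in> \<Gamma>" for p
    proof -
      have "v \<in> set p" using \<Gamma>[OF that] unfolding vwalk_def by (metis list.set_sel(1))
      then show ?thesis unfolding len_def m_def by simp
    qed
    show "area (pverts G) m \<le> 1"
      unfolding area_def m_def using v graph.pair_finite_verts
      by (simp add: if_distrib[of "\<lambda>x. x\<^sup>2"] cong: if_cong)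
  qed (use v graph.pair_finite_verts in \<open>auto simp: m_def\<close>)
  then show ?thesis by (simp add: one_ereal_def)
qed

lemma walk_around_root_reaches:
  assumes \<rho>: "\<rho> \<in> pverts G" "cen \<rho> = 0" and v: "v \<in> pverts G" "v \<noteq> \<rho>"
    and p: "p \<in> walks_around G e \<rho> v"
  obtains u where "u \<in> set p" "norm (cen v) \<le> dist (cen u) (cen v)"
proof -
  have w: "vwalk p (with_proj G)" "hd p = last p" "\<rho> \<notin> path_image (walk_curve e p)"
    "winding_number (walk_curve e p) \<rho> \<noteq> 0"
    using p unfolding walks_around_def by auto
  have "\<rho> \<notin> set p" using walk_curve_verts[OF w(1)] w(3) by blast
  moreover have "- cen v \<noteq> 0"
    using dist_cen_ge[OF v(1) \<rho>(1) v(2)] rad_pos[OF v(1)] rad_pos[OF \<rho>(1)] \<rho>(2) by auto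
  \<comment> \<open>Every point of the half-plane opposite to \<open>cen v\<close> is at least as far from \<open>cen v\<close> as the origin.\<close>
  ultimately obtain u where u: "u \<in> set p" "0 < Re ((cen u - cen \<rho>) * cnj (- cen v))"
    using winding_walk_crosses_halfplane[OF w(1,2) \<rho>(1) _ w(4)] by blast
  have expand: "(dist x y)\<^sup>2 = (norm x)\<^sup>2 + (norm y)\<^sup>2 + 2 * Re (x * cnj (- y))" for x y :: complex
    unfolding dist_norm cmod_power2 by (simp add: power2_eq_square algebra_simps)
  have "(norm (cen v))\<^sup>2 \<le> (dist (cen u) (cen v))\<^sup>2"
    using u(2) zero_le_power2[of "norm (cen u)"] unfolding expand \<rho>(2) diff_zero by linarith
  then have "norm (cen v) \<le> dist (cen u) (cen v)" using power2_le_imp_le zero_le_dist by blast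
  with u(1) show ?thesis using that by blast
qed

lemma walk_to_boundary_reaches:
  assumes eps: "\<And>u. u \<in> pverts G \<Longrightarrow> rad u \<le> \<epsilon>" and p: "p \<in> walks_to_boundary G e v"
  obtains u where "u \<in> set p" "1 - \<epsilon> - norm (cen v) \<le> dist (cen u) (cen v)"
proof
  have p': "vwalk p (with_proj G)" "last p \<in> outer_verts G e"
    using p unfolding walks_to_boundary_def by auto
  then show "last p \<in> set p" unfolding vwalk_def by auto
  obtain x where x: "x \<in> cball (cen (last p)) (rad (last p))" "norm x = 1"
    using outer_disc_meets_unit_circle[OF p'(2)] .
  have "rad (last p) \<le> \<epsilon>" using eps p'(2) unfolding outer_verts_def by simp
  moreover have "1 \<le> norm (cen (last p)) + rad (last p)"
    using norm_triangle_sub[of x "cen (last p)"] x by (simp add: dist_norm norm_minus_commute)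
  moreover have "norm (cen (last p)) \<le> norm (cen v) + dist (cen (last p)) (cen v)"
    unfolding dist_norm by (rule norm_triangle_sub)
  ultimately show "1 - \<epsilon> - norm (cen v) \<le> dist (cen (last p)) (cen v)" by linarith
qed

lemma VEL_boundary_ge_1: "v \<in> pverts G \<Longrightarrow> 1 \<le> VEL (pverts G) (walks_to_boundary G e v)"
  by (rule VEL_walks_from_ge_1) (auto simp: walks_to_boundary_def)

lemma max_VEL_ge:
  assumes \<rho>: "\<rho> \<in> pverts G" "cen \<rho> = 0" and v: "v \<in> pverts G"
    and eps: "0 < \<epsilon>" "\<epsilon> \<le> 1 / 64" "\<And>u. u \<in> pverts G \<Longrightarrow> rad u \<le> \<epsilon>"
    and N: "2 \<le> N" "2 \<le> 2 ^ N * \<epsilon>"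
  shows "ereal ((ln (1 / (8 * \<epsilon>)) / 2)\<^sup>2 / (36 * real N)) \<le>
    max (VEL_around G e \<rho> v) (VEL (pverts G) (walks_to_boundary G e v))"
proof (cases "1 / 4 \<le> norm (cen v)")
  case True
  then have v\<rho>: "v \<noteq> \<rho>" using \<rho>(2) by auto
  have "ereal ((ln (1 / 4 / (2 * \<epsilon>)) / 2)\<^sup>2 / (36 * real N)) \<le> VEL (pverts G) (walks_around G e \<rho> v)"
  proof (rule VEL_walks_reaching_ge[OF v eps(1,3) N])
    fix p assume p: "p \<in> walks_around G e \<rho> v"
    obtain u where "u \<in> set p" "norm (cen v) \<le> dist (cen u) (cen v)"
      using walk_around_root_reaches[OF \<rho> v v\<rho> p] .
    moreover from this(2) have "1 / 4 \<le> dist (cen u) (cen v)" using True by linarith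
    ultimately show "vwalk p (with_proj G) \<and> hd p = v \<and> (\<exists>u\<in>set p. 1 / 4 \<le> dist (cen u) (cen v))"
      using p unfolding walks_around_def by blast
  qed (use eps in auto)
  then show ?thesis using v\<rho> by (simp add: VEL_around_def le_max_iff_disj)
next
  case False
  have "ereal ((ln (1 / 4 / (2 * \<epsilon>)) / 2)\<^sup>2 / (36 * real N)) \<le> VEL (pverts G) (walks_to_boundary G e v)"
  proof (rule VEL_walks_reaching_ge[OF v eps(1,3) N])
    fix p assume p: "p \<in> walks_to_boundary G e v"
    obtain u where "u \<in> set p" "1 - \<epsilon> - norm (cen v) \<le> dist (cen u) (cen v)"
      using walk_to_boundary_reaches[OF eps(3) p] .
    moreover from this(2) have "1 / 4 \<le> dist (cen u) (cen v)" using False eps(2) by linarith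
    ultimately show "vwalk p (with_proj G) \<and> hd p = v \<and> (\<exists>u\<in>set p. 1 / 4 \<le> dist (cen u) (cen v))"
      using p unfolding walks_to_boundary_def by blast
  qed (use eps in auto)
  then show ?thesis by (simp add: le_max_iff_disj)
qed

end

text \<open>
  With \<open>L = ln (1 / \<epsilon>)\<close>, which is at least \<open>6 ln 2\<close>, the logarithm \<open>ln (1 / (8 \<epsilon>))\<close> is at least
  \<open>L / 2\<close> and about \<open>log 2 (2 / \<epsilon>) \<le> 4 L\<close> dyadic scales suffice, so the quotient is at least
  \<open>(L / 4)\<^sup>2 / (144 L) = L / 2304\<close>.
\<close>

lemma log_scale_bound:
  fixes \<epsilon> :: real
  assumes "0 < \<epsilon>" "\<epsilon> \<le> 1 / 64"
  obtains N :: nat where "2 \<le> N" "2 \<le> 2 ^ N * \<epsilon>"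
    "1 / 2304 * ln (1 / \<epsilon>) \<le> (ln (1 / (8 * \<epsilon>)) / 2)\<^sup>2 / (36 * real N)"
proof
  define L where "L = ln (1 / \<epsilon>)"
  define N where "N = nat \<lceil>log 2 (2 / \<epsilon>)\<rceil>"
  have le: "64 \<le> 1 / \<epsilon>" using assms by (simp add: field_simps)
  have ln2: "1 / 2 \<le> ln (2 :: real)" using ln2_ge_two_thirds by simp
  have ln64: "ln 64 = 6 * ln (2 :: real)" using ln_realpow[of 2 6] by simp
  have L: "ln 64 \<le> L" unfolding L_def using le assms(1) by (subst ln_le_cancel_iff) auto
  then have L1: "1 \<le> L" using ln2 ln64 by linarith
  have ln8: "ln 8 = 3 * ln (2 :: real)" using ln_realpow[of 2 3] by simp
  have pos: "0 < 2 / \<epsilon>" using assms by simp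
  have log_eq: "log 2 (2 / \<epsilon>) = 1 + L / ln 2"
    unfolding log_def L_def using assms by (simp add: ln_div field_simps)
  have "L / ln 2 \<le> 2 * L" using ln2 L1 by (simp add: field_simps)
  moreover have "6 \<le> L / ln 2" using L ln64 ln2 by (simp add: field_simps)
  ultimately have N: "log 2 (2 / \<epsilon>) \<le> real N" "real N \<le> 2 + 2 * L" "2 \<le> real N"
    unfolding N_def log_eq by linarith+
  show "2 \<le> N" using N(3) by simp
  have "2 / \<epsilon> = 2 powr log 2 (2 / \<epsilon>)" using pos by simp
  also have "\<dots> \<le> 2 powr real N" using N(1) by (intro powr_mono) auto
  also have "\<dots> = 2 ^ N" by (simp add: powr_realpow)
  finally show "2 \<le> 2 ^ N * \<epsilon>" using assms(1) by (simp add: field_simps)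
  have "ln (1 / (8 * \<epsilon>)) = L - ln 8"
    unfolding L_def using assms(1) by (simp add: ln_div ln_mult)
  then have "L / 4 \<le> ln (1 / (8 * \<epsilon>)) / 2" using L ln64 ln8 by simp
  then have "(L / 4)\<^sup>2 \<le> (ln (1 / (8 * \<epsilon>)) / 2)\<^sup>2" using L1 by (intro power_mono) auto
  moreover have "1 / 2304 * L * (36 * real N) \<le> 1 / 2304 * L * (36 * (4 * L))"
    using N(2) L1 by (intro mult_left_mono) auto
  ultimately have "1 / 2304 * L * (36 * real N) \<le> (ln (1 / (8 * \<epsilon>)) / 2)\<^sup>2"
    by (simp add: power2_eq_square)
  then show "1 / 2304 * ln (1 / \<epsilon>) \<le> (ln (1 / (8 * \<epsilon>)) / 2)\<^sup>2 / (36 * real N)"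
    using N(3) by (simp add: L_def pos_le_divide_eq mult.commute)
qed

theorem theorem1p2:
  shows "\<exists>c>0. \<forall>G e \<rho> cen rad \<epsilon>.
    rooted_triangulation G e \<rho> \<longrightarrow>
    circle_packing_in_disc G e cen rad \<longrightarrow>
    cen \<rho> = 0 \<longrightarrow>
    0 < \<epsilon> \<longrightarrow>
    (\<forall>v\<in>pverts G. rad v \<le> \<epsilon>) \<longrightarrow>
    ereal (c * ln (1 / \<epsilon>)) \<le>
      Min ((\<lambda>v. max (VEL_around G e \<rho> v) (VEL (pverts G) (walks_to_boundary G e v))) ` pverts G)"
proof (intro exI[of _ "1 / 2304"] conjI allI impI)
  fix G e \<rho> cen rad and \<epsilon> :: real
  assume root: "rooted_triangulation G e \<rho>" and pack: "circle_packing_in_disc G e cen rad"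
    and \<rho>0: "cen \<rho> = 0" and eps: "0 < \<epsilon>" "\<forall>v\<in>pverts G. rad v \<le> \<epsilon>"
  interpret disc_packing G e cen rad
    using root pack by unfold_locales (simp_all add: rooted_triangulation_def)
  have \<rho>: "\<rho> \<in> pverts G" using root by (simp add: rooted_triangulation_def)
  have "ereal (1 / 2304 * ln (1 / \<epsilon>)) \<le> max (VEL_around G e \<rho> v) (VEL (pverts G) (walks_to_boundary G e v))"
    if v: "v \<in> pverts G" for v
  proof (cases "\<epsilon> \<le> 1 / 64")
    case True
    obtain N where N: "2 \<le> N" "2 \<le> 2 ^ N * \<epsilon>"
      "1 / 2304 * ln (1 / \<epsilon>) \<le> (ln (1 / (8 * \<epsilon>)) / 2)\<^sup>2 / (36 * real N)"
      using log_scale_bound[OF eps(1) True] .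
    have "ereal (1 / 2304 * ln (1 / \<epsilon>)) \<le> ereal ((ln (1 / (8 * \<epsilon>)) / 2)\<^sup>2 / (36 * real N))"
      using N(3) by simp
    also have "\<dots> \<le> max (VEL_around G e \<rho> v) (VEL (pverts G) (walks_to_boundary G e v))"
      using max_VEL_ge[OF \<rho> \<rho>0 v eps(1) True _ N(1,2)] eps(2) by blast
    finally show ?thesis .
  next
    case False
    then have "1 / \<epsilon> \<le> 64" using eps(1) by (simp add: field_simps)
    then have "1 / 2304 * ln (1 / \<epsilon>) \<le> 1" using ln_le_minus_one[of "1 / \<epsilon>"] eps(1) by simp
    then have "ereal (1 / 2304 * ln (1 / \<epsilon>)) \<le> 1" by (simp add: one_ereal_def)
    also have "1 \<le> VEL (pverts G) (walks_to_boundary G e v)" using VEL_boundary_ge_1[OF v] .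
    finally show ?thesis by (simp add: le_max_iff_disj)
  qed
  then show "ereal (1 / 2304 * ln (1 / \<epsilon>)) \<le>
      Min ((\<lambda>v. max (VEL_around G e \<rho> v) (VEL (pverts G) (walks_to_boundary G e v))) ` pverts G)"
    using graph.pair_finite_verts \<rho> by (intro Min.boundedI) auto
qed simp

end
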